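(* Let $p$ be a prime with $p \equiv 2 \pmod 3$ (the case $p=2$ is included), let $s,m$ be positive integers, $q=p^s$, $r=q^m$, and let $\alpha$ be a generator of $\mathrm{GF}(r)^*$. Let $h$ be a positive divisor of $q-1$, and let $e=3$, where it is assumed that $3 \mid \gcd(q-1,hm)$. Put $g=\alpha^{(q-1)/h}$, $n=\frac{h(r-1)}{q-1}$, $\beta=\alpha^{(r-1)/3}$, and assume that $N:=\gcd\left(\frac{r-1}{q-1},\frac{3(q-1)}{h}\right)=3$. Let $\mathrm{Tr}$ denote the trace map from $\mathrm{GF}(r)$ to $\mathrm{GF}(q)$ and consider the cyclic code $\mathcal{C}=\{\mathbf{c}_{(a,b)} : a,b\in \mathrm{GF}(r)\}$ over $\mathrm{GF}(q)$ of length $n$, where $\mathbf{c}_{(a,b)}=\left(\mathrm{Tr}(ag^i+b(\beta g)^i)\right)_{i=0}^{n-1}$. For $(a,b)\in\mathrm{GF}(r)^2$ define the modified weight $\lambda(a,b)=\frac{h(r-1)}{q}-w(\mathbf{c}_{(a,b)})$, where $w$ is the Hamming weight. (Here $s$ is even, so $ms/2$ is an integer, and $\sqrt r=p^{ms/2}$.) Write $\varepsilon=(-1)^{ms/2}$. (1) If $3 \mid \frac{q-1}{h}$, then as $(a,b)$ ranges over $\mathrm{GF}(r)^2$, the values of $\lambda(a,b)$ are distributed as follows (value: number of pairs $(a,b)$; if two listed values coincide, their numbers are added): $-\frac{h}{q}(2\varepsilon\sqrt r+1)$: $\frac{r-1}{27}(r-8-2\varepsilon\sqrt r)$; $\frac{h}{q}(\varepsilon\sqrt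 r-1)$: $\frac{2(r-1)}{27}(4r-14+\varepsilon\sqrt r)$; $-\frac{h}{q}(\varepsilon\sqrt r+1)$: $\frac{2(r-1)}{9}(r-2+\varepsilon\sqrt r)$; $-\frac{h}{q}$: $\frac{2(r-1)}{9}(2r-1-\varepsilon\sqrt r)$; $\frac{h}{3q}(r-4\varepsilon\sqrt r-3)$: $r-1$; $\frac{h}{3q}(r+2\varepsilon\sqrt r-3)$: $2(r-1)$; $\frac{h(r-1)}{q}$: $1$. (2) If $3 \nmid \frac{q-1}{h}$, then the values of $\lambda(a,b)$ are distributed as follows (with the same convention): $-\frac{h}{q}(2\varepsilon\sqrt r+1)$: $\frac{r-1}{27}(r+1-2\varepsilon\sqrt r)$; $\frac{h}{q}(\varepsilon\sqrt r-1)$: $\frac{2(r-1)}{27}(4r-5+\varepsilon\sqrt r)$; $-\frac{h}{q}(\varepsilon\sqrt r+1)$: $\frac{2(r-1)}{9}(r-2+\varepsilon\sqrt r)$; $-\frac{h}{q}$: $\frac{r-1}{9}(4r-11-2\varepsilon\sqrt r)$; $\frac{h}{3q}(r+2\varepsilon\sqrt r-3)$: $r-1$; $\frac{h}{3q}(r-\varepsilon\sqrt r-3)$: $2(r-1)$; $\frac{h(r-1)}{q}$: $1$.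
   Context: The Hamming weight of a vector is its number of nonzero coordinates. The "modified weight distribution" lists, for each value $v$, the number of pairs $(a,b)\in\mathrm{GF}(r)^2$ with $\lambda(a,b)=v$. *)

theory Defs
  imports
    Complex_Main
    "HOL-Library.Cardinality"
    "HOL-Computational_Algebra.Primes"
begin

text \<open>
  A finite field \<open>GF(r)\<close> is a type of class \<open>{field, finite}\<close> with \<open>r\<close> elements. If \<open>r = q ^ m\<close> with
  \<open>q\<close> a prime power, then \<open>GF(q)\<close> is its subfield \<open>{x. x ^ q = x}\<close>, and the trace from
  \<open>GF(r)\<close> to \<open>GF(q)\<close> is the sum of the conjugates of the argument.
\<close>

definition field_trace :: "nat \<Rightarrow> nat \<Rightarrow> 'a::field \<Rightarrow> 'a" where
  "field_trace q m x = (\<Sum>i<m. x ^ (q ^ i))"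

definition primitive_element :: "'a::field \<Rightarrow> bool" where
  "primitive_element \<alpha> \<longleftrightarrow> range (\<lambda>k::nat. \<alpha> ^ k) = UNIV - {0}"

definition hamming_weight :: "'a::zero list \<Rightarrow> nat" where
  "hamming_weight v = card {i. i < length v \<and> v ! i \<noteq> 0}"

definition codeword :: "nat \<Rightarrow> nat \<Rightarrow> nat \<Rightarrow> 'a::field \<Rightarrow> 'a \<Rightarrow> 'a \<Rightarrow> 'a \<Rightarrow> 'a list" where
  "codeword q m n g \<beta> a b = map (\<lambda>i. field_trace q m (a * g ^ i + b * (\<beta> * g) ^ i)) [0..<n]"

definition modified_weight ::
  "nat \<Rightarrow> nat \<Rightarrow> nat \<Rightarrow> nat \<Rightarrow> 'a::field \<Rightarrow> 'a \<Rightarrow> 'a \<Rightarrow> 'a \<Rightarrow> real" where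
  "modified_weight q m h n g \<beta> a b =
     real h * (real (q ^ m) - 1) / real q - real (hamming_weight (codeword q m n g \<beta> a b))"

text \<open>
  \<open>T\<close> lists pairs (value, number of arguments). Multiplicities of coinciding values are added;
  a value not listed in \<open>T\<close> is not attained.
\<close>

definition has_value_distribution :: "('b \<Rightarrow> real) \<Rightarrow> (real \<times> real) list \<Rightarrow> bool" where
  "has_value_distribution f T \<longleftrightarrow>
     (\<forall>v. real (card {x. f x = v}) = (\<Sum>(u, c)\<leftarrow>T. if u = v then c else 0))"

end

theory Submission
  imports Defs "HOL-Computational_Algebra.Polynomial"
begin

text \<open>
  Grouping the positions of a codeword by their residue modulo 3 expresses \<open>\<lambda>(a,b)\<close> as
  \<open>h/q\<close> times the sum of the cubic Gaussian periods \<open>\<eta>\<close> at the three points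
  \<open>g\<^sup>j(a + \<beta>\<^sup>jb)\<close>. Since \<open>p \<equiv> 2 (mod 3)\<close>, the Frobenius map exchanges the two nontrivial
  cosets of the cubes, so \<open>\<eta>\<close> takes only two values on nonzero arguments. They satisfy a quadratic
  equation by the first two power moments, and integrality modulo 3 selects the root.

  It remains to count, for each pair \<open>(z, k)\<close>, the arguments for which \<open>z\<close> of the three points vanish
  and \<open>k\<close> are nonzero cubes. Any two of the points determine \<open>(a,b)\<close>, which yields linear equations
  for these numbers. The only one that needs a Fourier argument is \<open>(0, 3)\<close>: solutions of a
  linear equation in three cubes, counted by a third moment of \<open>\<eta>\<close>.
\<close>

section \<open>Finite fields, counting and periodic sums\<close>

lemma finite_field_power_card_minus_one:
  fixes x :: "'a::{field,finite}"
  assumes "x \<noteq> 0"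
  shows "x ^ (CARD('a) - 1) = 1"
proof -
  have "(\<Prod>y\<in>UNIV-{0}. x * y) = (\<Prod>y\<in>UNIV-{0}. y)"
    by (rule prod.reindex_bij_witness[of _ "\<lambda>y. y / x" "\<lambda>y. x * y"]) (use assms in auto)
  then show ?thesis
    by (simp add: prod.distrib)
qed

text \<open>Translation by 1 permutes the field, so the sum of all elements absorbs one extra 1 per
  element.\<close>

lemma of_nat_card_eq_0: "of_nat CARD('a) = (0 :: 'a::{field,finite})"
proof -
  have "(\<Sum>y\<in>UNIV. y + 1) = (\<Sum>y\<in>UNIV. y :: 'a)"
    by (rule sum.reindex_bij_witness[of _ "\<lambda>y. y - 1" "\<lambda>y. y + 1"]) auto
  then show ?thesis
    by (simp add: sum.distrib)
qed

text \<open>The linear map (a, b) to (a + cb, a + db) has determinant d - c, which is nonzero, so it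
  is a bijection of the plane; \<open>g\<close> in the proof is its inverse.\<close>

lemma card_plus_scale_image:
  fixes c d :: "'a::{field,finite}"
  assumes "c \<noteq> d"
  shows "card {(a, b). a + c * b \<in> D \<and> a + d * b \<in> E} = card D * card E"
proof -
  define f where "f = (\<lambda>x. (fst x + c * snd x, fst x + d * snd x))"
  define b where "b = (\<lambda>y :: 'a \<times> 'a. (fst y - snd y) / (c - d))"
  define g where "g = (\<lambda>y. (fst y - c * b y, b y))"
  have "b (f x) = snd x" for x
  proof -
    have "fst (f x) - snd (f x) = snd x * (c - d)" by (simp add: f_def algebra_simps)
    then show ?thesis using assms by (simp only: b_def) simp
  qed
  then have gf: "g (f x) = x" for x by (simp add: g_def prod_eq_iff) (simp add: f_def)
  have "b y * (c - d) = fst y - snd y" for y using assms by (simp add: b_def)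
  then have "fst y - c * b y + d * b y = snd y" for y by (simp add: algebra_simps)
  then have fg: "f (g y) = y" for y by (simp add: f_def g_def prod_eq_iff)
  have "{(a, b). a + c * b \<in> D \<and> a + d * b \<in> E} = {x. f x \<in> D \<times> E}"
    by (auto simp: f_def)
  then have "bij_betw f {(a, b). a + c * b \<in> D \<and> a + d * b \<in> E} (D \<times> E)"
    by (intro bij_betw_byWitness[where f' = g]) (simp_all add: image_subset_iff gf fg)
  then have "card {(a, b). a + c * b \<in> D \<and> a + d * b \<in> E} = card (D \<times> E)"
    by (rule bij_betw_same_card)
  then show ?thesis by (simp only: card_cartesian_product)
qed

text \<open>Multiplication by \<open>t\<close> permutes the residues modulo \<open>d\<close>, so
  each block of \<open>d\<close> consecutive \<open>k\<close> runs through one full period of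
  \<open>f\<close>.\<close>

lemma sum_coprime_multiples_periodic:
  fixes f :: "nat \<Rightarrow> real"
  assumes per: "\<And>i. f (i + d) = f i" and cop: "coprime t d" and "d > 0"
  shows "(\<Sum>k<A * d. f (k * t)) = real A * (\<Sum>i<d. f i)"
proof -
  have permod: "f (i mod d) = f i" for i
  proof -
    have "f (j + l * d) = f j" for j l
    proof (induction l)
      case (Suc l)
      then show ?case using per[of "j + l * d"] by (simp add: add_ac)
    qed simp
    from this[of "i mod d" "i div d"] show ?thesis by simp
  qed
  have inj: "inj_on (\<lambda>k. k * t mod d) {..<d}"
  proof (rule inj_onI)
    fix x y assume xy: "x \<in> {..<d}" "y \<in> {..<d}" and eq: "x * t mod d = y * t mod d"
    have *: "y \<le> x" if "x * t mod d = y * t mod d" "x < d" "y < d" "x \<le> y" for x y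
    proof -
      have "d dvd (y * t - x * t)" using that by (metis mod_eq_dvd_iff_nat mult_le_mono1)
      then have "d dvd (y - x) * t" by (simp add: diff_mult_distrib)
      then have "d dvd y - x" using cop by (simp add: coprime_commute coprime_dvd_mult_left_iff)
      then show ?thesis using that by (auto dest: dvd_imp_le)
    qed
    show "x = y" using *[of x y] *[of y x] xy eq by (metis le_antisym lessThan_iff nat_le_linear)
  qed
  have im: "(\<lambda>k. k * t mod d) ` {..<d} = {..<d}"
    by (rule card_subset_eq) (use inj \<open>d > 0\<close> in \<open>auto simp: card_image\<close>)
  have one: "(\<Sum>k<d. f (k * t)) = (\<Sum>i<d. f i)"
  proof -
    have "(\<Sum>k<d. f (k * t)) = (\<Sum>k<d. f (k * t mod d))" by (simp add: permod)
    also have "\<dots> = (\<Sum>i\<in>(\<lambda>k. k * t mod d) ` {..<d}. f i)"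
      by (simp add: sum.reindex[OF inj])
    finally show ?thesis by (simp add: im)
  qed
  have "(\<Sum>k<A * d. f (k * t)) = (\<Sum>j<A. \<Sum>k=j*d..<j*d+d. f (k * t))"
    by (rule sum.nat_group[symmetric])
  also have "\<dots> = (\<Sum>j<A. \<Sum>k<d. f (k * t))"
  proof (rule sum.cong[OF refl])
    fix j
    have "f ((k + j * d) * t) = f (k * t)" for k
      by (metis (no_types) distrib_right mod_mult_self1 mult.assoc mult.commute permod)
    then show "(\<Sum>k=j*d..<j*d+d. f (k * t)) = (\<Sum>k<d. f (k * t))"
      using sum.shift_bounds_nat_ivl[of "\<lambda>k. f (k * t)" 0 "j * d" d] by (simp add: add.commute lessThan_atLeast0)
  qed
  finally show ?thesis by (simp add: one)
qed

text \<open>Reduces a value distribution to class sizes. \<open>val\<close> need not be injective,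
  since the counts of coinciding values are added.\<close>

lemma has_value_distribution_classes:
  fixes f :: "'b::finite \<Rightarrow> real"
  assumes f: "\<And>x. f x = val (cl x)" and "range cl \<subseteq> set S" and "distinct S"
  shows "has_value_distribution f (map (\<lambda>k. (val k, real (card {x. cl x = k}))) S)"
  unfolding has_value_distribution_def
proof
  fix v
  have "real (card {x. f x = v}) = (\<Sum>x\<in>UNIV. of_bool (val (cl x) = v))"
    by (simp add: f)
  also have "\<dots> = (\<Sum>k\<in>set S. real (card {x \<in> UNIV. cl x = k}) * of_bool (val k = v))"
    by (rule sum_fun_comp) (use assms in auto)
  also have "\<dots> = (\<Sum>k\<leftarrow>S. real (card {x. cl x = k}) * of_bool (val k = v))"
    using \<open>distinct S\<close> by (simp add: sum_list_distinct_conv_sum_set)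
  also have "\<dots> = (\<Sum>(u, N)\<leftarrow>map (\<lambda>k. (val k, real (card {x. cl x = k}))) S. if u = v then N else 0)"
    unfolding map_map by (intro arg_cong[where f = sum_list] map_cong) auto
  finally show "real (card {x. f x = v}) =
    (\<Sum>(u, N)\<leftarrow>map (\<lambda>k. (val k, real (card {x. cl x = k}))) S. if u = v then N else 0)" .
qed

subsection \<open>The trace of a finite field extension\<close>

locale finite_field_extension =
  fixes p s m q r :: nat and \<alpha> :: "'a::{field,finite}"
  assumes prime_p: "prime p" and s_pos: "s > 0" and m_pos: "m > 0"
    and q_def: "q = p ^ s" and r_def: "r = q ^ m"
    and card_UNIV: "CARD('a) = r"
    and primitive: "primitive_element \<alpha>"
begin

abbreviation Tr :: "'a \<Rightarrow> 'a" where
  "Tr \<equiv> field_trace q m"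

lemma p_gt_1: "p > 1"
  using prime_p by (rule prime_gt_1_nat)

lemma q_gt_1: "q > 1"
  using p_gt_1 s_pos unfolding q_def by (metis one_less_power)

lemma r_gt_1: "r > 1"
  using q_gt_1 m_pos unfolding r_def by (metis one_less_power)

lemma CHAR_eq: "CHAR('a) = p"
proof -
  have pr: "prime CHAR('a)"
    by (intro prime_CHAR_semidom finite_imp_CHAR_pos) simp
  have "CHAR('a) dvd r"
    using of_nat_card_eq_0 card_UNIV of_nat_eq_0_iff_char_dvd by metis
  then have "CHAR('a) dvd p"
    unfolding r_def q_def using pr prime_dvd_power by blast
  with pr prime_p show ?thesis
    by (simp add: primes_dvd_imp_eq)
qed

lemma power_r_minus_1: "x \<noteq> 0 \<Longrightarrow> x ^ (r - 1) = 1" for x :: 'a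
  using finite_field_power_card_minus_one card_UNIV by metis

lemma power_r: "x ^ r = x" for x :: 'a
  using power_r_minus_1[of x] r_gt_1 by (cases "x = 0") (simp_all add: power_eq_if)

lemma sum_power_p: "(\<Sum>i\<in>I. f i) ^ p = (\<Sum>i\<in>I. f i ^ p)" for f :: "'i \<Rightarrow> 'a"
  by (rule freshmans_dream_sum) (use CHAR_eq prime_p in auto)

lemma sum_power_q: "(\<Sum>i\<in>I. f i) ^ q = (\<Sum>i\<in>I. f i ^ q)" for f :: "'i \<Rightarrow> 'a"
  by (rule freshmans_dream_sum'[where n = s]) (use CHAR_eq prime_p in \<open>auto simp: q_def\<close>)

lemma Tr_add: "Tr (x + y) = Tr x + Tr y"
proof -
  have "(x + y) ^ (q ^ i) = x ^ (q ^ i) + y ^ (q ^ i)" for i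
    by (rule freshmans_dream'[where n = "s * i"])
      (use CHAR_eq prime_p in \<open>auto simp: q_def power_mult\<close>)
  then show ?thesis
    by (simp add: field_trace_def sum.distrib)
qed

lemma Tr_diff: "Tr (x - y) = Tr x - Tr y"
  using Tr_add[of "x - y" y] by simp

lemma Tr_0: "Tr 0 = 0"
  using Tr_diff[of 0 0] by simp

lemma Tr_power_p: "Tr (x ^ p) = Tr x ^ p"
  by (simp add: field_trace_def sum_power_p mult.commute flip: power_mult)

text \<open>The subfield GF(q).\<close>

definition K :: "'a set" where
  "K = {c. c ^ q = c}"

lemma Tr_scale: "c \<in> K \<Longrightarrow> Tr (c * x) = c * Tr x"
proof -
  assume "c \<in> K"
  then have "c ^ (q ^ i) = c" for i
    by (induction i) (simp_all add: K_def power_mult)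
  then show ?thesis
    by (simp add: field_trace_def power_mult_distrib sum_distrib_left)
qed

text \<open>Raising to the power \<open>q\<close> shifts the conjugates by one, and the last becomes
  \<open>x ^ r = x\<close>, the first.\<close>

lemma Tr_in_K: "Tr x \<in> K"
proof -
  have "Tr x ^ q = (\<Sum>i<m. x ^ (q ^ Suc i))"
    by (simp add: field_trace_def sum_power_q mult.commute flip: power_mult)
  also have "\<dots> = (\<Sum>i<Suc m. x ^ (q ^ i)) - x"
    by (subst sum.lessThan_Suc_shift) simp
  also have "\<dots> = Tr x"
    using power_r[of x] by (simp add: field_trace_def r_def)
  finally show ?thesis by (simp add: K_def)
qed

lemma K_divide: "c \<in> K \<Longrightarrow> d \<in> K \<Longrightarrow> c / d \<in> K"
  and K_0: "0 \<in> K"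
  using q_gt_1 by (auto simp: K_def power_divide)

lemma K_minus: "c \<in> K \<Longrightarrow> - c \<in> K"
proof -
  assume c: "c \<in> K"
  \<comment> \<open>Additivity of the Frobenius map covers odd and even \<open>q\<close>
    alike.\<close>
  have "c ^ q + (- c) ^ q = (c + - c) ^ q"
    by (rule freshmans_dream'[where n = s, symmetric]) (use CHAR_eq prime_p in \<open>auto simp: q_def\<close>)
  with c q_gt_1 show ?thesis by (simp add: K_def eq_neg_iff_add_eq_0 add.commute)
qed

lemma card_K_le: "card K \<le> q"
proof -
  define P where "P = monom (1::'a) q - monom 1 1"
  have deg: "degree P \<le> q"
    unfolding P_def using q_gt_1 by (intro degree_diff_le) (auto simp: degree_monom_eq)
  have "coeff P q = 1"
    using q_gt_1 by (simp add: P_def)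
  then have "P \<noteq> 0" by auto
  moreover have "{x. poly P x = 0} = K"
    by (auto simp: P_def K_def poly_monom)
  ultimately show ?thesis
    using card_poly_roots_bound[of P] deg by simp
qed

text \<open>The trace is a polynomial function of degree \<open>q ^ (m - 1)\<close>, which bounds
  the number of its roots.\<close>

lemma card_ker_Tr_le: "card {x. Tr x = 0} \<le> q ^ (m - 1)"
proof -
  define P where "P = (\<Sum>i<m. monom (1::'a) (q ^ i))"
  have deg: "degree P \<le> q ^ (m - 1)"
    unfolding P_def
  proof (rule degree_sum_le)
    fix i assume "i \<in> {..<m}"
    then have "q ^ i \<le> q ^ (m - 1)" using q_gt_1 by (intro power_increasing) auto
    then show "degree (monom (1::'a) (q ^ i)) \<le> q ^ (m - 1)" by (simp add: degree_monom_eq)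
  qed simp
  have "coeff P (q ^ (m - 1)) = (\<Sum>i<m. if i = m - 1 then 1 else 0)"
    using q_gt_1 by (simp add: P_def coeff_sum)
  also have "\<dots> = 1" using m_pos by simp
  finally have "P \<noteq> 0" by auto
  moreover have "{x. poly P x = 0} = {x. Tr x = 0}"
    by (simp add: P_def field_trace_def poly_sum poly_monom)
  ultimately show ?thesis
    using card_poly_roots_bound[of P] deg by simp
qed

text \<open>Every fibre of the trace is at most as large as the kernel, so \<open>r\<close> is at
  most \<open>card K\<close> times the kernel size. The two root bounds multiply to exactly
  \<open>r\<close>, hence both are attained.\<close>

lemma
  shows card_K: "card K = q" and card_ker_Tr: "card {x. Tr x = 0} = q ^ (m - 1)"
proof -
  let ?k = "card {x. Tr x = 0}"
  have fibre: "card {x. Tr x = t} \<le> ?k" for t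
  proof (cases "\<exists>x0. Tr x0 = t")
    case True
    then obtain x0 where "Tr x0 = t" by blast
    then have "(\<lambda>x. x - x0) ` {x. Tr x = t} \<subseteq> {x. Tr x = 0}" by (auto simp: Tr_diff)
    then show ?thesis
      by (intro card_inj_on_le[of "\<lambda>x. x - x0"]) (auto simp: inj_on_def)
  qed simp
  have "r = card (\<Union>t\<in>K. {x. Tr x = t})"
  proof -
    have "(\<Union>t\<in>K. {x. Tr x = t}) = UNIV" using Tr_in_K by blast
    then show ?thesis by (simp add: card_UNIV)
  qed
  also have "\<dots> \<le> (\<Sum>t\<in>K. card {x. Tr x = t})" by (rule card_UN_le) simp
  also have "\<dots> \<le> card K * ?k" using sum_bounded_above[of K "\<lambda>t. card {x. Tr x = t}" ?k] fibre by simp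
  finally have le: "r \<le> card K * ?k" .
  have r: "r = q * q ^ (m - 1)" using m_pos by (simp add: r_def flip: power_Suc)
  have pos: "q ^ (m - 1) > 0" "q > 0" using q_gt_1 by auto
  have "card K * ?k \<le> card K * q ^ (m - 1)" using card_ker_Tr_le by simp
  with le r have "q * q ^ (m - 1) \<le> card K * q ^ (m - 1)" by linarith
  with pos card_K_le show 1: "card K = q" by simp
  from le r 1 pos card_ker_Tr_le show "?k = q ^ (m - 1)" by simp
qed

text \<open>
  In terms of a nontrivial additive character \<open>\<psi>\<close> of \<open>GF(q)\<close>, \<open>\<phi> x\<close> is the sum of
  \<open>\<psi> (Tr (c x))\<close> over all \<open>c\<close> in \<open>GF(q)\<^sup>*\<close>; the lemmas below replace orthogonality and
  multiplicativity of characters.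
\<close>

definition \<phi> :: "'a \<Rightarrow> real" where
  "\<phi> x = real q * of_bool (Tr x = 0) - 1"

lemma \<phi>_0: "\<phi> 0 = real q - 1"
  by (simp add: \<phi>_def Tr_0)

lemma \<phi>_scale: "c \<in> K \<Longrightarrow> c \<noteq> 0 \<Longrightarrow> \<phi> (c * x) = \<phi> x"
  by (simp add: \<phi>_def Tr_scale)

lemma \<phi>_power_p: "\<phi> (x ^ p) = \<phi> x"
  using p_gt_1 by (simp add: \<phi>_def Tr_power_p)

lemma sum_\<phi>_mult:
  "(\<Sum>x\<in>UNIV. \<phi> (x * z)) = (if z = 0 then real r * (real q - 1) else 0)"
proof (cases "z = 0")
  case False
  have r: "r = q * q ^ (m - 1)" using m_pos by (simp add: r_def flip: power_Suc)
  have "(\<Sum>x\<in>UNIV. \<phi> (x * z)) = (\<Sum>x\<in>UNIV. \<phi> x)"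
    by (rule sum.reindex_bij_witness[of _ "\<lambda>x. x / z" "\<lambda>x. x * z"]) (use False in auto)
  also have "\<dots> = real q * (\<Sum>x\<in>UNIV. of_bool (Tr x = 0)) - real r"
    by (simp add: \<phi>_def sum_subtractf sum_distrib_left card_UNIV)
  also have "(\<Sum>x\<in>UNIV. of_bool (Tr x = 0)) = real (card {x. Tr x = 0})"
    by (subst sum_of_bool_eq) auto
  finally show ?thesis using False by (simp add: card_ker_Tr r)
qed (simp add: \<phi>_0 card_UNIV)

text \<open>With characters, the left side is a double sum over two scalars in GF(q), and taking
  their product as a new variable separates it into two factors. The proof counts the
  \<open>c\<close> with \<open>Tr x + c * Tr y = 0\<close> instead.\<close>

lemma sum_\<phi>_add_scale:
  "(\<Sum>c\<in>K - {0}. \<phi> (x + c * y)) = \<phi> x * \<phi> y"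
proof -
  have "(\<Sum>c\<in>K - {0}. \<phi> (x + c * y)) =
      real q * (\<Sum>c\<in>K - {0}. of_bool (Tr x + c * Tr y = 0)) - (real q - 1)"
    using q_gt_1 by (simp add: \<phi>_def sum_subtractf sum_distrib_left Tr_add Tr_scale card_K K_0
        card_Diff_singleton of_nat_diff)
  also have "(\<Sum>c\<in>K - {0}. of_bool (Tr x + c * Tr y = 0)) = real (card {c\<in>K - {0}. Tr x + c * Tr y = 0})"
    by (subst sum_of_bool_eq) (auto intro: arg_cong[where f = card])
  \<comment> \<open>If \<open>Tr y\<close> is nonzero, the only candidate is the quotient, which is
    an admissible \<open>c\<close> exactly when \<open>Tr x\<close> is nonzero.\<close>
  also have "{c\<in>K - {0}. Tr x + c * Tr y = 0} =
      (if Tr y = 0 then if Tr x = 0 then K - {0} else {}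
       else if Tr x = 0 then {} else {- (Tr x / Tr y)})"
  proof (cases "Tr y = 0")
    case False
    have "c = - (Tr x / Tr y)" if "Tr x + c * Tr y = 0" for c
      using that False by (simp add: field_simps add_eq_0_iff)
    moreover have "- (Tr x / Tr y) \<in> K"
      by (intro K_minus K_divide Tr_in_K)
    ultimately show ?thesis using False by auto
  qed auto
  finally show ?thesis
    using q_gt_1 by (auto simp: \<phi>_def card_K K_0 card_Diff_singleton of_nat_diff algebra_simps)
qed

end

subsection \<open>Cubic Gaussian periods\<close>

locale cubic_periods = finite_field_extension +
  assumes p_mod_3: "p mod 3 = 2"
    and three_dvd_q: "3 dvd q - 1"
    and three_dvd_index: "3 dvd (r - 1) div (q - 1)"
begin

text \<open>The number of nonzero cubes.\<close>

definition c :: nat where "c = (r - 1) div 3"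

text \<open>The index of GF(q)* in the group of nonzero cubes.\<close>

definition e :: nat where "e = (r - 1) div (q - 1) div 3"

lemma index_eq: "(r - 1) div (q - 1) = 3 * e"
  using three_dvd_index by (simp add: e_def)

lemma q_minus_1_dvd: "q - 1 dvd r - 1"
proof -
  have "int q - 1 dvd int q ^ m - 1" by (simp add: power_diff_1_eq)
  then have "int (q - 1) dvd int (r - 1)"
    using q_gt_1 r_gt_1 by (simp add: r_def of_nat_diff)
  then show ?thesis by (simp only: of_nat_dvd_iff)
qed

lemma c_eq: "c = (q - 1) * e" and r_minus_1_eq: "r - 1 = 3 * c"
proof -
  have "r - 1 = 3 * ((q - 1) * e)"
    using index_eq q_minus_1_dvd by (metis dvd_mult_div_cancel mult.left_commute)
  then show "c = (q - 1) * e" "r - 1 = 3 * c" by (simp_all add: c_def)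
qed

lemma c_pos: "c > 0" and e_pos: "e > 0" and three_dvd_c: "3 dvd c"
proof -
  show "c > 0" using r_minus_1_eq r_gt_1 by linarith
  then show "e > 0" using c_eq by (cases e) auto
  show "3 dvd c" using c_eq three_dvd_q by simp
qed

lemma real_r: "real r = 3 * real c + 1"
  using r_minus_1_eq r_gt_1 by linarith

lemma \<alpha>_nonzero: "\<alpha> \<noteq> 0"
  using primitive by (metis DiffE primitive_element_def power_one_right rangeI singletonI)

lemma power_3c: "x \<noteq> 0 \<Longrightarrow> x ^ (3 * c) = 1" for x :: 'a
  by (metis power_r_minus_1 r_minus_1_eq)

lemma power_\<alpha>_mod: "\<alpha> ^ i = \<alpha> ^ (i mod (3 * c))"
proof -
  have "\<alpha> ^ i = (\<alpha> ^ (3 * c)) ^ (i div (3 * c)) * \<alpha> ^ (i mod (3 * c))"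
    by (simp only: div_mult_mod_eq mult.commute[of "3 * c"] flip: power_mult power_add)
  then show ?thesis by (simp add: power_3c \<alpha>_nonzero)
qed

text \<open>Primitivity gives surjectivity, and equal cardinalities then give injectivity.\<close>

lemma bij_betw_powers: "bij_betw (\<lambda>i. \<alpha> ^ i) {..<3 * c} (UNIV - {0})"
proof -
  have "i mod (3 * c) < 3 * c" for i using c_pos by simp
  then have "range (\<lambda>i. \<alpha> ^ i) \<subseteq> (\<lambda>i. \<alpha> ^ i) ` {..<3 * c}"
    using power_\<alpha>_mod by blast
  with primitive have im: "(\<lambda>i. \<alpha> ^ i) ` {..<3 * c} = UNIV - {0}"
    unfolding primitive_element_def by blast
  moreover have "card (UNIV - {0 :: 'a}) = 3 * c"
    by (simp add: card_UNIV card_Diff_singleton r_minus_1_eq[simplified])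
  ultimately show ?thesis
    by (simp add: bij_betw_def eq_card_imp_inj_on)
qed

lemma power_\<alpha>_eq_1_iff: "\<alpha> ^ k = 1 \<longleftrightarrow> 3 * c dvd k"
proof -
  have "k mod (3 * c) \<in> {..<3 * c}" "0 \<in> {..<3 * c}" using c_pos by auto
  then have "\<alpha> ^ (k mod (3 * c)) = \<alpha> ^ 0 \<longleftrightarrow> k mod (3 * c) = 0"
    using bij_betw_powers unfolding bij_betw_def by (metis inj_on_eq_iff)
  then show ?thesis using power_\<alpha>_mod[of k] by (simp add: dvd_eq_mod_eq_0)
qed

section \<open>Nonzero cubes and their cosets\<close>

definition C :: "'a set" where
  "C = {x. x \<noteq> 0 \<and> x ^ c = 1}"

text \<open>Identifies \<open>C\<close> with the nonzero cubes: in a cyclic group of order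
  \<open>3 * c\<close>, the elements killed by the exponent \<open>c\<close> are the cubes.\<close>

lemma power_\<alpha>_in_C_iff: "\<alpha> ^ k \<in> C \<longleftrightarrow> 3 dvd k"
proof -
  have "\<alpha> ^ k \<in> C \<longleftrightarrow> \<alpha> ^ (k * c) = 1"
    by (simp add: C_def \<alpha>_nonzero power_mult)
  also have "\<dots> \<longleftrightarrow> 3 * c dvd k * c" by (simp add: power_\<alpha>_eq_1_iff)
  finally show ?thesis using c_pos by simp
qed

lemma C_mult_iff: "x \<in> C \<Longrightarrow> x * y \<in> C \<longleftrightarrow> y \<in> C"
  by (auto simp: C_def power_mult_distrib)

lemma one_in_C: "1 \<in> C" and zero_notin_C: "0 \<notin> C"
  by (auto simp: C_def)

text \<open>-1 is its own cube.\<close>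

lemma minus_one_in_C: "-1 \<in> C"
proof -
  have "(-1 :: 'a) ^ c = ((-1) ^ 3) ^ c" by simp
  also have "\<dots> = 1" by (simp only: power_3c[of "-1"] neg_equal_0_iff_equal one_neq_zero not_False_eq_True flip: power_mult)
  finally show ?thesis by (simp add: C_def)
qed

lemma minus_in_C_iff: "- x \<in> C \<longleftrightarrow> x \<in> C"
  using C_mult_iff[OF minus_one_in_C, of x] by simp

text \<open>The order of \<open>y\<close> divides \<open>q - 1\<close>, which divides
  \<open>c\<close> because 3 divides the index \<open>(r - 1) div (q - 1)\<close>.\<close>

lemma K_subset_C: "y \<in> K \<Longrightarrow> y \<noteq> 0 \<Longrightarrow> y \<in> C"
proof -
  assume y: "y \<in> K" "y \<noteq> 0"
  then have "y * y ^ (q - 1) = y * 1"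
    using q_gt_1 by (simp add: K_def flip: power_Suc)
  with y have "y ^ (q - 1) = 1" by simp
  with y show ?thesis by (simp add: C_def c_eq power_mult)
qed

lemma sum_nonzero: "(\<Sum>x\<in>UNIV - {0}. f x) = (\<Sum>i<3 * c. f (\<alpha> ^ i))"
  using sum.reindex_bij_betw[OF bij_betw_powers, of f] by simp

lemma sum_C: "(\<Sum>z\<in>C. f z) = (\<Sum>i<c. f (\<alpha> ^ (3 * i)))"
proof -
  have inj: "inj_on (\<lambda>i. \<alpha> ^ (3 * i)) {..<c}"
  proof (rule inj_onI)
    fix i j assume "i \<in> {..<c}" "j \<in> {..<c}" "\<alpha> ^ (3 * i) = \<alpha> ^ (3 * j)"
    then have "3 * i = 3 * j"
      using bij_betw_powers by (intro inj_onD[of "\<lambda>i. \<alpha> ^ i" "{..<3 * c}"]) (auto simp: bij_betw_def)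
    then show "i = j" by simp
  qed
  have "C = (\<lambda>i. \<alpha> ^ (3 * i)) ` {..<c}"
  proof
    show "(\<lambda>i. \<alpha> ^ (3 * i)) ` {..<c} \<subseteq> C" by (auto simp: power_\<alpha>_in_C_iff)
    show "C \<subseteq> (\<lambda>i. \<alpha> ^ (3 * i)) ` {..<c}"
    proof
      fix x assume x: "x \<in> C"
      then have "x \<in> (\<lambda>i. \<alpha> ^ i) ` {..<3 * c}"
        using bij_betw_powers zero_notin_C unfolding bij_betw_def by auto
      then obtain k where k: "k < 3 * c" "x = \<alpha> ^ k" by auto
      with x obtain i where "k = 3 * i" by (auto simp: power_\<alpha>_in_C_iff)
      with k show "x \<in> (\<lambda>i. \<alpha> ^ (3 * i)) ` {..<c}" by auto
    qed
  qed
  then show ?thesis by (simp add: sum.reindex[OF inj])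
qed

lemma card_C: "card C = c"
  using sum_C[of "\<lambda>_. 1 :: nat"] by simp

lemma nonzero_powerE:
  assumes "x \<noteq> 0"
  obtains k where "x = \<alpha> ^ k"
proof -
  have "x \<in> range (\<lambda>k. \<alpha> ^ k)" using assms primitive unfolding primitive_element_def by simp
  with that show ?thesis by blast
qed

lemma coset_cases:
  assumes "x \<noteq> 0"
  obtains "x \<in> C" | z where "z \<in> C" "x = \<alpha> * z" | z where "z \<in> C" "x = \<alpha> ^ 2 * z"
proof -
  obtain k where k: "x = \<alpha> ^ k"
    using assms by (rule nonzero_powerE)
  have x: "x = \<alpha> ^ (k mod 3) * \<alpha> ^ (3 * (k div 3))" by (simp add: k flip: power_add)
  have C: "\<alpha> ^ (3 * (k div 3)) \<in> C" by (simp add: power_\<alpha>_in_C_iff)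
  have "k mod 3 = 0 \<or> k mod 3 = 1 \<or> k mod 3 = 2" by linarith
  then show ?thesis
    using x C that by (elim disjE) auto
qed

lemma coset_disjoint:
  assumes "z \<in> C"
  shows "\<alpha> * z \<notin> C" "\<alpha> ^ 2 * z \<notin> C"
  using C_mult_iff[OF assms, of \<alpha>] C_mult_iff[OF assms, of "\<alpha> ^ 2"]
    power_\<alpha>_in_C_iff[of 1] power_\<alpha>_in_C_iff[of 2] by (simp_all add: mult.commute)

text \<open>The classical cubic Gaussian period, the sum of the character over \<open>w * C\<close>:
  the \<open>\<alpha> ^ (3 * i)\<close> with \<open>i < e\<close> represent the cosets of GF(q)* in
  \<open>C\<close>, and \<open>\<phi>\<close> sums the character over one such coset. In this form
  the period is visibly an integer.\<close>

definition \<eta> :: "'a \<Rightarrow> real" where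
  "\<eta> w = (\<Sum>i<e. \<phi> (w * \<alpha> ^ (3 * i)))"

text \<open>\<open>\<alpha> ^ (3 * e)\<close> lies in GF(q)*, and \<open>\<phi>\<close> is invariant
  under such factors.\<close>

lemma \<phi>_periodic: "\<phi> (w * \<alpha> ^ (3 * (i + e))) = \<phi> (w * \<alpha> ^ (3 * i))"
proof -
  have "(\<alpha> ^ (3 * e)) ^ (q - 1) = 1"
    by (simp add: power_\<alpha>_eq_1_iff c_eq mult_ac flip: power_mult)
  then have "(\<alpha> ^ (3 * e)) ^ q = \<alpha> ^ (3 * e)"
    using q_gt_1 by (simp add: power_eq_if)
  then have "\<phi> (\<alpha> ^ (3 * e) * (w * \<alpha> ^ (3 * i))) = \<phi> (w * \<alpha> ^ (3 * i))"
    by (intro \<phi>_scale) (simp_all add: K_def \<alpha>_nonzero)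
  moreover have "\<alpha> ^ (3 * e) * (w * \<alpha> ^ (3 * i)) = w * \<alpha> ^ (3 * (i + e))"
    by (simp add: distrib_left power_add mult_ac)
  ultimately show ?thesis by simp
qed

lemma sum_\<phi>_multiples:
  assumes "coprime t e"
  shows "(\<Sum>k<A * e. \<phi> (w * \<alpha> ^ (3 * (k * t)))) = real A * \<eta> w"
  unfolding \<eta>_def
  by (rule sum_coprime_multiples_periodic) (use assms e_pos \<phi>_periodic in auto)

lemma \<eta>_eq_sum_C: "(real q - 1) * \<eta> w = (\<Sum>z\<in>C. \<phi> (w * z))"
  using sum_\<phi>_multiples[where t = 1 and A = "q - 1"] q_gt_1 by (simp add: sum_C c_eq of_nat_diff)

lemma \<eta>_eqI:
  assumes "(\<Sum>z\<in>C. \<phi> (w * z)) = (real q - 1) * x"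
  shows "\<eta> w = x"
  using assms q_gt_1 by (simp flip: \<eta>_eq_sum_C)

lemma \<eta>_in_Ints: "\<eta> w \<in> \<int>"
  unfolding \<eta>_def \<phi>_def by (intro Ints_sum Ints_diff Ints_mult) auto

lemma \<eta>_0: "\<eta> 0 = real c"
  using q_gt_1 by (intro \<eta>_eqI) (simp add: \<phi>_0 card_C)

lemma \<eta>_mult_C: "z \<in> C \<Longrightarrow> \<eta> (w * z) = \<eta> w"
proof (rule \<eta>_eqI)
  assume z: "z \<in> C"
  have "(\<Sum>x\<in>C. \<phi> (w * z * x)) = (\<Sum>x\<in>C. \<phi> (w * x))"
  proof (rule sum.reindex_bij_witness[of _ "\<lambda>x. x / z" "\<lambda>x. z * x"])
    fix x assume "x \<in> C"
    then show "x / z \<in> C" using C_mult_iff[OF z, of "x / z"] z by (auto simp: C_def)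
  qed (use z C_mult_iff in \<open>auto simp: C_def mult_ac\<close>)
  then show "(\<Sum>x\<in>C. \<phi> (w * z * x)) = (real q - 1) * \<eta> w"
    by (simp add: \<eta>_eq_sum_C)
qed

text \<open>The Frobenius map preserves the kernel of the trace and permutes \<open>C\<close>; its
  inverse is the power \<open>r div p\<close>.\<close>

lemma \<eta>_power_p: "\<eta> (w ^ p) = \<eta> w"
proof (rule \<eta>_eqI)
  have "p dvd r"
    using s_pos m_pos by (simp add: r_def q_def dvd_power flip: power_mult)
  then have inv: "(x ^ p) ^ (r div p) = x" "(x ^ (r div p)) ^ p = x" for x :: 'a
    by (simp_all add: power_r flip: power_mult)
  have "(\<Sum>z\<in>C. \<phi> (w ^ p * z)) = (\<Sum>z\<in>C. \<phi> ((w * z) ^ p))"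
  proof (rule sum.reindex_bij_witness[of _ "\<lambda>x. x ^ p" "\<lambda>x. x ^ (r div p)"])
    have C_power: "x ^ k \<in> C" if "x \<in> C" for x k
      using that by (induction k) (auto simp: one_in_C C_mult_iff)
    show "x ^ (r div p) \<in> C" "x ^ p \<in> C" if "x \<in> C" for x using that by (rule C_power)+
  qed (simp_all add: inv power_mult_distrib)
  then show "(\<Sum>z\<in>C. \<phi> (w ^ p * z)) = (real q - 1) * \<eta> w"
    by (simp add: \<phi>_power_p \<eta>_eq_sum_C)
qed

text \<open>As \<open>p\<close> is 2 modulo 3, \<open>\<alpha> ^ p\<close> lies in the coset of
  \<open>\<alpha> ^ 2\<close>, so the Frobenius invariance identifies the periods of the two noncube
  cosets.\<close>

lemma \<eta>_\<alpha>2: "\<eta> (\<alpha> ^ 2) = \<eta> \<alpha>"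
proof -
  have "p = 2 + 3 * (p div 3)" using p_mod_3 by presburger
  then have "\<alpha> ^ p = \<alpha> ^ 2 * \<alpha> ^ (3 * (p div 3))" by (metis power_add)
  then show ?thesis
    using \<eta>_power_p[of \<alpha>] by (simp add: \<eta>_mult_C power_\<alpha>_in_C_iff)
qed

lemma \<eta>_eq: "\<eta> x = (if x = 0 then real c else if x \<in> C then \<eta> 1 else \<eta> \<alpha>)"
proof (cases "x = 0")
  case False
  then show ?thesis
  proof (cases rule: coset_cases)
    case 1
    then show ?thesis using False \<eta>_mult_C[of x 1] by simp
  qed (use False coset_disjoint \<eta>_mult_C \<eta>_\<alpha>2 in auto)
qed (simp add: \<eta>_0)

text \<open>\<open>\<phi>\<close> is multiplicative only after averaging over GF(q)*. Since GF(q)*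
  lies in \<open>C\<close>, scaling by it permutes \<open>C\<close>, so the sum over
  \<open>C\<close> already contains this averaging.\<close>

lemma sum_\<phi>_C: "(\<Sum>z\<in>C. \<phi> (x + y * z)) = \<phi> x * \<eta> y"
proof -
  have "(real q - 1) * (\<Sum>z\<in>C. \<phi> (x + y * z)) = (\<Sum>k\<in>K - {0}. \<Sum>z\<in>C. \<phi> (x + y * z))"
    using q_gt_1 by (simp add: card_K K_0 card_Diff_singleton of_nat_diff)
  also have "\<dots> = (\<Sum>k\<in>K - {0}. \<Sum>z\<in>C. \<phi> (x + k * (y * z)))"
  proof (rule sum.cong[OF refl])
    fix k assume k: "k \<in> K - {0}"
    then have kC: "k \<in> C" using K_subset_C by blast
    show "(\<Sum>z\<in>C. \<phi> (x + y * z)) = (\<Sum>z\<in>C. \<phi> (x + k * (y * z)))"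
    proof (rule sum.reindex_bij_witness[of _ "\<lambda>z. k * z" "\<lambda>z. z / k"])
      fix z assume "z \<in> C"
      then show "z / k \<in> C" using C_mult_iff[OF kC, of "z / k"] k by auto
    qed (use kC k C_mult_iff in \<open>auto simp: mult_ac\<close>)
  qed
  also have "\<dots> = (\<Sum>z\<in>C. \<phi> x * \<phi> (y * z))"
    by (subst sum.swap) (simp add: sum_\<phi>_add_scale)
  also have "\<dots> = (real q - 1) * (\<phi> x * \<eta> y)"
    by (simp add: \<eta>_eq_sum_C mult.left_commute flip: sum_distrib_left)
  finally show ?thesis using q_gt_1 by simp
qed

section \<open>Power moments and the values of the periods\<close>

lemma sum_\<phi>_linear:
  "(\<Sum>x\<in>UNIV. \<phi> (x * a)) = real r * (real q - 1) * of_bool (a = 0)"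
  by (simp add: sum_\<phi>_mult)

lemma sum_\<eta>: "(\<Sum>x\<in>UNIV. \<eta> x) = 0"
proof -
  have "(real q - 1) * (\<Sum>x\<in>UNIV. \<eta> x) = (\<Sum>z\<in>C. \<Sum>x\<in>UNIV. \<phi> (x * z))"
    by (subst sum.swap) (simp add: sum_distrib_left \<eta>_eq_sum_C)
  also have "\<dots> = (\<Sum>z\<in>C. 0)"
    by (rule sum.cong) (use zero_notin_C in \<open>auto simp: sum_\<phi>_mult\<close>)
  finally show ?thesis using q_gt_1 by simp
qed

text \<open>Expanding both periods counts pairs of cubes with sum 0. As -1 is a cube, each
  \<open>z\<close> in \<open>C\<close> has exactly one partner.\<close>

lemma sum_\<eta>_square: "(\<Sum>x\<in>UNIV. (\<eta> x)\<^sup>2) = real r * real c"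
proof -
  have "(real q - 1) * (\<Sum>x\<in>UNIV. (\<eta> x)\<^sup>2) = (\<Sum>x\<in>UNIV. \<Sum>z\<in>C. \<phi> (x * z) * \<eta> x)"
    by (simp add: sum_distrib_left power2_eq_square \<eta>_eq_sum_C flip: mult.assoc sum_distrib_right)
  also have "\<dots> = (\<Sum>x\<in>UNIV. \<Sum>z\<in>C. \<Sum>y\<in>C. \<phi> (x * (z + y)))"
    by (simp add: distrib_left flip: sum_\<phi>_C)
  also have "\<dots> = (\<Sum>z\<in>C. \<Sum>x\<in>UNIV. \<Sum>y\<in>C. \<phi> (x * (z + y)))" by (rule sum.swap)
  also have "\<dots> = (\<Sum>z\<in>C. \<Sum>y\<in>C. \<Sum>x\<in>UNIV. \<phi> (x * (z + y)))"
    by (intro sum.cong[OF refl] sum.swap)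
  also have "\<dots> = (\<Sum>z\<in>C. real r * (real q - 1))"
  proof (rule sum.cong[OF refl])
    fix z assume z: "z \<in> C"
    have "(\<Sum>y\<in>C. \<Sum>x\<in>UNIV. \<phi> (x * (z + y))) =
        (\<Sum>y\<in>C. if y = - z then real r * (real q - 1) else 0)"
      by (intro sum.cong) (auto simp: sum_\<phi>_mult add_eq_0_iff)
    also have "\<dots> = real r * (real q - 1)" using z by (simp add: minus_in_C_iff)
    finally show "(\<Sum>y\<in>C. \<Sum>x\<in>UNIV. \<phi> (x * (z + y))) = real r * (real q - 1)" .
  qed
  finally have "(real q - 1) * (\<Sum>x\<in>UNIV. (\<eta> x)\<^sup>2) = (real q - 1) * (real r * real c)"
    by (simp add: card_C mult_ac)
  then show ?thesis using q_gt_1 by simp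
qed

text \<open>Orthogonality in \<open>t\<close> detects the linear equation.\<close>

lemma card_triples_eq_sum_\<eta>:
  "real r * real (card {(u, v, w) \<in> C \<times> C \<times> C. x * u + y * v + z * w = 0}) =
    (\<Sum>t\<in>UNIV. \<eta> (t * x) * \<eta> (t * y) * \<eta> (t * z))"
proof -
  \<comment> \<open>Only the first period is expanded with the factor \<open>q - 1\<close>;
    \<open>sum_\<phi>_C\<close> absorbs the other two one after the other.\<close>
  have "(real q - 1) * (\<Sum>t\<in>UNIV. \<eta> (t * x) * \<eta> (t * y) * \<eta> (t * z)) =
      (\<Sum>t\<in>UNIV. \<Sum>u\<in>C. \<phi> (t * x * u) * \<eta> (t * y) * \<eta> (t * z))"
    by (simp add: sum_distrib_left \<eta>_eq_sum_C flip: mult.assoc sum_distrib_right)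
  also have "\<dots> = (\<Sum>t\<in>UNIV. \<Sum>u\<in>C. \<Sum>v\<in>C. \<Sum>w\<in>C. \<phi> (t * (x * u + y * v + z * w)))"
    by (simp add: distrib_left sum_distrib_right mult.assoc flip: sum_\<phi>_C)
  also have "\<dots> = (\<Sum>t\<in>UNIV. \<Sum>(u, v, w)\<in>C \<times> C \<times> C. \<phi> (t * (x * u + y * v + z * w)))"
    by (simp add: sum.cartesian_product)
  also have "\<dots> = (\<Sum>(u, v, w)\<in>C \<times> C \<times> C. \<Sum>t\<in>UNIV. \<phi> (t * (x * u + y * v + z * w)))"
    by (subst sum.swap) (simp add: split_beta)
  also have "\<dots> = real r * (real q - 1) *
      (\<Sum>(u, v, w)\<in>C \<times> C \<times> C. of_bool (x * u + y * v + z * w = 0))"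
    by (simp add: sum_\<phi>_linear sum_distrib_left split_beta)
  also have "(\<Sum>(u, v, w)\<in>C \<times> C \<times> C. of_bool (x * u + y * v + z * w = 0)) =
      real (card {(u, v, w) \<in> C \<times> C \<times> C. x * u + y * v + z * w = 0})"
    by (auto simp: split_beta sum_of_bool_eq intro!: arg_cong[where f = card])
  finally show ?thesis using q_gt_1 by simp
qed

lemma sum_cosets:
  "(\<Sum>x\<in>UNIV. f x) = f 0 + (\<Sum>z\<in>C. f z + f (\<alpha> * z) + f (\<alpha> ^ 2 * z))"
  for f :: "'a \<Rightarrow> real"
proof -
  have "(\<Sum>x\<in>UNIV. f x) = f 0 + (\<Sum>x\<in>UNIV - {0}. f x)"
    by (simp add: sum.remove)
  also have "(\<Sum>x\<in>UNIV - {0}. f x) = (\<Sum>i<c * 3. f (\<alpha> ^ i))"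
    by (simp add: sum_nonzero mult.commute)
  also have "\<dots> = (\<Sum>j<c. \<Sum>i=j*3..<j*3+3. f (\<alpha> ^ i))" by (rule sum.nat_group[symmetric])
  also have "\<dots> = (\<Sum>z\<in>C. f z + f (\<alpha> * z) + f (\<alpha> ^ 2 * z))"
    by (simp add: sum_C numeral_3_eq_3 mult.commute power2_eq_square mult_ac)
  finally show ?thesis .
qed

lemma \<eta>_coset: "z \<in> C \<Longrightarrow> \<eta> z = \<eta> 1" "z \<in> C \<Longrightarrow> \<eta> (\<alpha> * z) = \<eta> \<alpha>"
    "z \<in> C \<Longrightarrow> \<eta> (\<alpha> ^ 2 * z) = \<eta> \<alpha>"
  using \<eta>_mult_C[of z 1] \<eta>_mult_C[of z \<alpha>] \<eta>_mult_C[of z "\<alpha> ^ 2"] \<eta>_\<alpha>2 by simp_all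

lemma sum_\<eta>_cosets:
  "(\<Sum>x\<in>UNIV. F (\<eta> x)) = F (real c) + real c * (F (\<eta> 1) + 2 * F (\<eta> \<alpha>))" for F :: "real \<Rightarrow> real"
proof -
  have "(\<Sum>z\<in>C. F (\<eta> z) + F (\<eta> (\<alpha> * z)) + F (\<eta> (\<alpha> ^ 2 * z))) = (\<Sum>z\<in>C. F (\<eta> 1) + 2 * F (\<eta> \<alpha>))"
    by (intro sum.cong) (simp_all add: \<eta>_coset)
  then show ?thesis by (simp add: sum_cosets[of "\<lambda>x. F (\<eta> x)"] \<eta>_0 card_C)
qed

lemma \<eta>_1: "\<eta> 1 = - 1 - 2 * \<eta> \<alpha>"
proof -
  have "real c * (1 + (\<eta> 1 + 2 * \<eta> \<alpha>)) = 0"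
    using sum_\<eta> sum_\<eta>_cosets[of "\<lambda>x. x"] by (simp add: algebra_simps)
  then show ?thesis using c_pos by simp
qed

text \<open>Writing y for \<open>\<eta> \<alpha>\<close>, the second moment divided by
  \<open>c\<close> reads c + (1 + 2y)^2 + 2y^2 = r. With r = 3c + 1 this is 3y^2 + 2y = c, and
  completing the square gives the claim.\<close>

lemma \<eta>_\<alpha>_square: "(3 * \<eta> \<alpha> + 1)\<^sup>2 = real r"
proof -
  have "real c * (real c + (\<eta> 1)\<^sup>2 + 2 * (\<eta> \<alpha>)\<^sup>2) = real c * real r"
    using sum_\<eta>_square sum_\<eta>_cosets[of "\<lambda>x. x\<^sup>2"] by (simp add: algebra_simps power2_eq_square)
  then have "real c + (\<eta> 1)\<^sup>2 + 2 * (\<eta> \<alpha>)\<^sup>2 = real r"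
    using c_pos by simp
  then show ?thesis
    using real_r by (simp add: \<eta>_1 power2_eq_square algebra_simps)
qed

text \<open>An odd power of \<open>p\<close> is 2 modulo 3, while \<open>q\<close> is 1 modulo
  3.\<close>

lemma even_s: "even s"
proof (rule ccontr)
  assume "odd s"
  then obtain k where "s = 2 * k + 1" by (rule oddE)
  then have "q mod 3 = 2 * 4 ^ k mod 3"
    using power_mod[of p 3 s] p_mod_3 by (simp add: q_def power_mult)
  also have "\<dots> = 2"
    using power_mod[of "4::nat" 3 k] mod_mult_right_eq[of 2 "4 ^ k" "3 :: nat"] by simp
  finally show False using three_dvd_q q_gt_1 by presburger
qed

text \<open>The square root of \<open>r\<close> with the sign that makes it the integer (-p)^(ms/2),
  which is 1 modulo 3.\<close>

definition E :: real where "E = (-1) ^ (m * s div 2) * sqrt (real r)"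

lemma E_square: "E\<^sup>2 = real r"
  by (simp add: E_def power_mult_distrib flip: power_mult)

text \<open>The quadratic equation leaves \<open>3 * \<eta> \<alpha> + 1\<close> equal to
  \<open>E\<close> or \<open>- E\<close>. As \<open>\<eta> \<alpha>\<close> is an integer, the left
  side is 1 modulo 3, which only \<open>E\<close> satisfies.\<close>

lemma \<eta>_\<alpha>: "\<eta> \<alpha> = (E - 1) / 3"
proof -
  define k where "k = m * s div 2"
  obtain v where v: "\<eta> \<alpha> = of_int v" using \<eta>_in_Ints[of \<alpha>] by (elim Ints_cases)
  have "m * s = 2 * k" using even_s by (simp add: k_def)
  then have "r = (p ^ k)\<^sup>2"
    by (simp add: r_def q_def mult.commute flip: power_mult)
  then have "sqrt (real r) = real p ^ k" by simp
  then have E: "E = of_int ((- int p) ^ k)"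
    by (simp add: E_def k_def flip: power_mult_distrib)
  have "(- int p) mod 3 = 1" using p_mod_3 by presburger
  then have E_mod: "(- int p) ^ k mod 3 = 1" using power_mod[of "- int p" 3 k] by simp
  have "(3 * \<eta> \<alpha> + 1)\<^sup>2 = E\<^sup>2" by (simp add: \<eta>_\<alpha>_square E_square)
  then have "3 * v + 1 = (- int p) ^ k \<or> 3 * v + 1 = - ((- int p) ^ k)"
    unfolding E v power2_eq_iff by linarith
  then have "3 * v + 1 = (- int p) ^ k"
    using E_mod by presburger
  then have "3 * of_int v + 1 = E" unfolding E by (metis of_int_1 of_int_add of_int_mult of_int_numeral)
  then show ?thesis by (simp add: v)
qed

lemma \<eta>_1': "\<eta> 1 = - (2 * E + 1) / 3"
  by (simp add: \<eta>_1 \<eta>_\<alpha> field_simps)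

end

subsection \<open>The weight distribution\<close>

locale cubic_code = cubic_periods +
  fixes h n :: nat and g \<beta> :: 'a
  assumes h_dvd: "h dvd q - 1"
    and g_def: "g = \<alpha> ^ ((q - 1) div h)"
    and n_def: "n = h * (r - 1) div (q - 1)"
    and \<beta>_def: "\<beta> = \<alpha> ^ ((r - 1) div 3)"
    and gcd_eq_3: "gcd ((r - 1) div (q - 1)) (3 * (q - 1) div h) = 3"
begin

definition t :: nat where "t = (q - 1) div h"

lemma g_eq: "g = \<alpha> ^ t" and \<beta>_eq: "\<beta> = \<alpha> ^ c"
  by (simp_all add: g_def t_def \<beta>_def c_def)

text \<open>The gcd hypothesis says that \<open>3 * e\<close> and \<open>3 * t\<close> have gcd
  3.\<close>

lemma coprime_t: "coprime t e"
proof -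
  have "3 * (q - 1) div h = 3 * t"
    unfolding t_def by (rule div_mult_swap[symmetric, OF h_dvd])
  then have "gcd (3 * e) (3 * t) = 3" using gcd_eq_3 index_eq by metis
  then have "3 * gcd e t = 3" using gcd_mult_distrib_nat[of 3 e t] by simp
  then have "gcd e t = 1" by simp
  then show ?thesis by (simp add: coprime_iff_gcd_eq_1 gcd.commute)
qed

lemma n_eq: "n = h * e * 3"
proof -
  have "n = h * ((r - 1) div (q - 1))"
    unfolding n_def by (rule div_mult_swap[symmetric, OF q_minus_1_dvd])
  then show ?thesis by (simp only: index_eq mult_ac)
qed

lemma g_nonzero: "g \<noteq> 0" and \<beta>_nonzero: "\<beta> \<noteq> 0"
  by (simp_all add: g_eq \<beta>_eq \<alpha>_nonzero)

lemma g_power_in_C_iff: "g ^ i \<in> C \<longleftrightarrow> 3 dvd t * i"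
  by (simp add: g_eq power_\<alpha>_in_C_iff flip: power_mult)

text \<open>The exponent \<open>c\<close> is itself a multiple of 3, because \<open>q - 1\<close>
  is.\<close>

lemma \<beta>_in_C: "\<beta> \<in> C"
  by (simp add: \<beta>_eq power_\<alpha>_in_C_iff three_dvd_c)

lemma \<beta>_cubed: "\<beta> ^ 3 = 1"
  by (simp add: \<beta>_eq power_\<alpha>_eq_1_iff mult.commute flip: power_mult)

lemma \<beta>_neq_1: "\<beta> \<noteq> 1"
  using c_pos by (simp add: \<beta>_eq power_\<alpha>_eq_1_iff)

lemma \<beta>_sum: "1 + \<beta> + \<beta>\<^sup>2 = 0"
proof -
  have "(\<beta> - 1) * (1 + \<beta> + \<beta>\<^sup>2) = \<beta> ^ 3 - 1"
    by (simp add: algebra_simps power2_eq_square power3_eq_cube)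
  then show ?thesis using \<beta>_cubed \<beta>_neq_1 by simp
qed

lemma \<beta>_power_neq:
  assumes "i < 3" "j < 3" "i \<noteq> j"
  shows "\<beta> ^ i \<noteq> \<beta> ^ j"
proof -
  have *: "\<beta> ^ i \<noteq> \<beta> ^ j" if "i < j" "j < 3" for i j :: nat
  proof
    assume "\<beta> ^ i = \<beta> ^ j"
    also have "\<beta> ^ j = \<beta> ^ i * \<beta> ^ (j - i)" using that by (simp flip: power_add)
    finally have "\<beta> ^ (j - i) = 1" using \<beta>_nonzero by simp
    then have "3 * c dvd c * (j - i)" by (simp add: \<beta>_eq power_\<alpha>_eq_1_iff flip: power_mult)
    then have "3 dvd j - i" using c_pos by (simp add: mult.commute)
    then show False using that by (auto dest!: dvd_imp_le)
  qed
  show ?thesis using *[of i j] *[of j i] assms by (cases "i < j") auto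
qed

section \<open>The three points attached to a codeword\<close>

definition u :: "nat \<Rightarrow> 'a \<times> 'a \<Rightarrow> 'a" where
  "u j x = g ^ j * (fst x + \<beta> ^ j * snd x)"

text \<open>Position j + 3k carries the trace of \<open>u j (a, b)\<close> times the cube
  \<open>\<alpha> ^ (3 * (k * t))\<close>. As \<open>t\<close> is coprime to \<open>e\<close>, the
  \<open>h * e\<close> values of \<open>k\<close> run \<open>h\<close> times through the cosets of
  GF(q)* in \<open>C\<close>, which gives \<open>h\<close> periods for each
  \<open>j\<close>.\<close>

lemma modified_weight_eq:
  "modified_weight q m h n g \<beta> a b = real h / real q * (\<Sum>j<3. \<eta> (u j (a, b)))"
proof -
  define x where "x i = a * g ^ i + b * (\<beta> * g) ^ i" for i
  have x: "x (j + k * 3) = u j (a, b) * \<alpha> ^ (3 * (k * t))" for j k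
  proof -
    have "\<beta> ^ (k * 3) = 1" by (metis \<beta>_cubed mult.commute power_mult power_one)
    moreover have "g ^ (k * 3) = \<alpha> ^ (3 * (k * t))" by (simp add: g_eq mult_ac flip: power_mult)
    ultimately show ?thesis
      by (simp add: x_def u_def power_mult_distrib power_add algebra_simps)
  qed
  have "(\<Sum>i<n. \<phi> (x i)) = (\<Sum>k<h * e. \<Sum>i=k*3..<k*3+3. \<phi> (x i))"
    unfolding n_eq by (rule sum.nat_group[symmetric])
  also have "\<dots> = (\<Sum>k<h * e. \<Sum>j<3. \<phi> (u j (a, b) * \<alpha> ^ (3 * (k * t))))"
  proof (rule sum.cong[OF refl])
    fix k
    show "(\<Sum>i=k*3..<k*3+3. \<phi> (x i)) = (\<Sum>j<3. \<phi> (u j (a, b) * \<alpha> ^ (3 * (k * t))))"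
      using sum.shift_bounds_nat_ivl[of "\<lambda>i. \<phi> (x i)" 0 "k * 3" 3]
      by (simp only: x lessThan_atLeast0 add_0 add.commute[of 3])
  qed
  also have "\<dots> = real h * (\<Sum>j<3. \<eta> (u j (a, b)))"
    by (subst sum.swap) (simp only: sum_\<phi>_multiples[OF coprime_t] sum_distrib_left)
  finally have sum_eq: "(\<Sum>i<n. \<phi> (x i)) = real h * (\<Sum>j<3. \<eta> (u j (a, b)))" .
  have "hamming_weight (codeword q m n g \<beta> a b) = card {i\<in>{..<n}. Tr (x i) \<noteq> 0}"
    unfolding hamming_weight_def codeword_def x_def by (intro arg_cong[where f = card]) auto
  then have hw: "real (hamming_weight (codeword q m n g \<beta> a b)) = (\<Sum>i<n. of_bool (Tr (x i) \<noteq> 0))"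
    by (simp add: sum_of_bool_eq Int_def)
  have wt: "real q * real (hamming_weight (codeword q m n g \<beta> a b)) =
      (\<Sum>i<n. real q - 1 - \<phi> (x i))"
    unfolding hw sum_distrib_left by (intro sum.cong) (auto simp: \<phi>_def)
  \<comment> \<open>The constant in the modified weight is n(q - 1)/q, so it cancels everything in
    the weight except the sum of \<open>\<phi>\<close>.\<close>
  have "real h * (real (q ^ m) - 1) = real (3 * h) * real c"
    using real_r by (simp add: r_def)
  also have "\<dots> = real n * (real q - 1)"
    using q_gt_1 by (simp add: n_eq c_eq of_nat_diff)
  finally have X: "real h * (real (q ^ m) - 1) = real n * (real q - 1)" .
  have "real q * modified_weight q m h n g \<beta> a b =
      real h * (real (q ^ m) - 1) - real q * real (hamming_weight (codeword q m n g \<beta> a b))"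
    using q_gt_1 by (simp add: modified_weight_def right_diff_distrib[of "real q"])
  also have "\<dots> = real h * (\<Sum>j<3. \<eta> (u j (a, b)))"
    unfolding X wt by (simp add: sum_subtractf sum_eq)
  finally have "real q * modified_weight q m h n g \<beta> a b = real h * (\<Sum>j<3. \<eta> (u j (a, b)))" .
  then show ?thesis using q_gt_1 by (simp add: field_simps)
qed

text \<open>Three linear forms in two variables are dependent. These coefficients equalise the
  powers of \<open>g\<close> and turn the coefficients of both coordinates into multiples of 1 +
  \<beta> + \<beta>^2 = 0.\<close>

lemma u_relation: "g\<^sup>2 * u 0 x + g * \<beta> * u 1 x + \<beta>\<^sup>2 * u 2 x = 0"
proof -
  have "g\<^sup>2 * u 0 x + g * \<beta> * u 1 x + \<beta>\<^sup>2 * u 2 x =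
      g\<^sup>2 * ((1 + \<beta> + \<beta>\<^sup>2) * fst x + (1 + \<beta>\<^sup>2 + \<beta> * \<beta> ^ 3) * snd x)"
    by (simp add: u_def algebra_simps power2_eq_square power3_eq_cube)
  also have "1 + \<beta>\<^sup>2 + \<beta> * \<beta> ^ 3 = 1 + \<beta> + \<beta>\<^sup>2" by (simp add: \<beta>_cubed)
  finally show ?thesis by (simp add: \<beta>_sum)
qed

text \<open>Since the powers of \<open>\<beta>\<close> involved differ, any two points are
  independent coordinates on the plane of all pairs.\<close>

lemma card_u_pair:
  assumes "i < 3" "j < 3" "i \<noteq> j"
  shows "card {x. u i x \<in> D \<and> u j x \<in> F} = card D * card F"
proof -
  have scale: "card ((\<lambda>y. y / g ^ k) ` D) = card D" for k D
    using g_nonzero by (intro card_image) (auto simp: inj_on_def)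
  have mem: "u k x \<in> D \<longleftrightarrow> fst x + \<beta> ^ k * snd x \<in> (\<lambda>y. y / g ^ k) ` D" for k x D
    using g_nonzero by (auto simp: u_def image_iff field_simps)
  have "{x. u i x \<in> D \<and> u j x \<in> F} =
      {(a, b). a + \<beta> ^ i * b \<in> (\<lambda>y. y / g ^ i) ` D \<and> a + \<beta> ^ j * b \<in> (\<lambda>y. y / g ^ j) ` F}"
    unfolding mem by auto
  then show ?thesis
    by (simp add: card_plus_scale_image[OF \<beta>_power_neq[OF assms]] scale)
qed

lemma card_u_single:
  assumes "i < 3"
  shows "card {x. u i x \<in> D} = card D * r"
proof -
  \<comment> \<open>Any second index will do; it carries no condition.\<close>
  let ?j = "if i = 0 then 1 else 0 :: nat"
  show ?thesis using card_u_pair[OF assms, of ?j D UNIV] by (simp add: card_UNIV split: if_splits)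
qed

lemma add_of_bool_eq_iff:
  "of_bool P + of_bool Q + of_bool R = (0 :: nat) \<longleftrightarrow> \<not> P \<and> \<not> Q \<and> \<not> R"
  "of_bool P + of_bool Q + of_bool R = (1 :: nat) \<longleftrightarrow>
    P \<and> \<not> Q \<and> \<not> R \<or> \<not> P \<and> Q \<and> \<not> R \<or> \<not> P \<and> \<not> Q \<and> R"
  "of_bool P + of_bool Q + of_bool R = (2 :: nat) \<longleftrightarrow>
    \<not> P \<and> Q \<and> R \<or> P \<and> \<not> Q \<and> R \<or> P \<and> Q \<and> \<not> R"
  "of_bool P + of_bool Q + of_bool R = (3 :: nat) \<longleftrightarrow> P \<and> Q \<and> R"
  by (cases P; cases Q; cases R; simp)+

text \<open>\<open>cl x\<close> is the pair \<open>(z, k)\<close> above; the weight depends on \<open>x\<close> only through it.\<close>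

definition cl :: "'a \<times> 'a \<Rightarrow> nat \<times> nat" where
  "cl x = (card {j\<in>{..<3}. u j x = 0}, card {j\<in>{..<3}. u j x \<in> C})"

lemma real_fst_cl: "real (fst (cl x)) = (\<Sum>j<3. of_bool (u j x \<in> {0}))"
  and real_snd_cl: "real (snd (cl x)) = (\<Sum>j<3. of_bool (u j x \<in> C))"
  by (simp_all add: cl_def sum_of_bool_eq Int_def)

text \<open>The three diagonal terms each impose both conditions on one point; the six ordered pairs
  of distinct points are independent.\<close>

lemma sum_u_pair:
  "(\<Sum>x\<in>UNIV. (\<Sum>i<3. of_bool (u i x \<in> D)) * (\<Sum>j<3. of_bool (u j x \<in> F))) =
    3 * real (card (D \<inter> F)) * real r + 6 * real (card D) * real (card F)"
proof -
  have "(\<Sum>x\<in>UNIV. (\<Sum>i<3. of_bool (u i x \<in> D)) * (\<Sum>j<3. of_bool (u j x \<in> F))) =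
      (\<Sum>x\<in>UNIV. \<Sum>i<3. \<Sum>j<3. of_bool (u i x \<in> D \<and> u j x \<in> F) :: real)"
    by (simp only: sum_product of_bool_conj)
  also have "\<dots> = (\<Sum>i<3. \<Sum>j<3. \<Sum>x\<in>UNIV. of_bool (u i x \<in> D \<and> u j x \<in> F))"
    by (subst sum.swap, intro sum.cong[OF refl], rule sum.swap)
  also have "\<dots> = (\<Sum>i<3::nat. \<Sum>j<3::nat. if i = j then real (card (D \<inter> F)) * real r
      else real (card D) * real (card F))"
  proof (intro sum.cong[OF refl])
    fix i j :: nat assume ij: "i \<in> {..<3}" "j \<in> {..<3}"
    have "(\<Sum>x\<in>UNIV. of_bool (u i x \<in> D \<and> u j x \<in> F)) = real (card {x. u i x \<in> D \<and> u j x \<in> F})"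
      by (subst sum_of_bool_eq) auto
    then show "(\<Sum>x\<in>UNIV. of_bool (u i x \<in> D \<and> u j x \<in> F)) =
        (if i = j then real (card (D \<inter> F)) * real r else real (card D) * real (card F))"
      using ij card_u_pair[of i j D F] card_u_single[of j "D \<inter> F"] by auto
  qed
  also have "\<dots> = 3 * real (card (D \<inter> F)) * real r + 6 * real (card D) * real (card F)"
    by (simp add: numeral_3_eq_3)
  finally show ?thesis .
qed

lemma sum_u_single:
  "(\<Sum>x\<in>UNIV. \<Sum>j<3. of_bool (u j x \<in> D)) = 3 * real (card D) * real r"
proof -
  have "(\<Sum>x\<in>UNIV. \<Sum>j<3. of_bool (u j x \<in> D)) = (\<Sum>j<3. \<Sum>x\<in>UNIV. of_bool (u j x \<in> D) :: real)"
    by (rule sum.swap)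
  also have "\<dots> = (\<Sum>j<(3::nat). real (card D) * real r)"
  proof (intro sum.cong[OF refl])
    fix j :: nat assume "j \<in> {..<3}"
    then have "card {x. u j x \<in> D} = card D * r" by (intro card_u_single) simp
    moreover have "(\<Sum>x\<in>UNIV. of_bool (u j x \<in> D)) = real (card {x. u j x \<in> D})"
      by (subst sum_of_bool_eq) auto
    ultimately show "(\<Sum>x\<in>UNIV. of_bool (u j x \<in> D)) = real (card D) * real r" by simp
  qed
  finally show ?thesis by simp
qed

lemma u_0: "u j (0, 0) = 0"
  by (simp add: u_def)

text \<open>Two vanishing points force (a, b) = (0, 0), so 2 never occurs as the number of zeros and
  3 only together with no cubes.\<close>

definition classes :: "(nat \<times> nat) set" where
  "classes = {(0, 0), (0, 1), (0, 2), (0, 3), (1, 0), (1, 1), (1, 2), (3, 0)}"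

lemma u_two_zeros:
  assumes "u i x = 0" "u j x = 0" "i < 3" "j < 3" "i \<noteq> j"
  shows "x = (0, 0)"
proof -
  have "card {x. u i x \<in> {0} \<and> u j x \<in> {0}} = 1"
    using card_u_pair[OF assms(3-5), of "{0}" "{0}"] by simp
  moreover have "(0, 0) \<in> {x. u i x \<in> {0} \<and> u j x \<in> {0}}" "x \<in> {x. u i x \<in> {0} \<and> u j x \<in> {0}}"
    using assms by (simp_all add: u_def)
  ultimately show ?thesis by (metis card_1_singletonE singletonD)
qed

lemma cl_eq:
  "cl x = (of_bool (u 0 x = 0) + of_bool (u 1 x = 0) + of_bool (u 2 x = 0),
    of_bool (u 0 x \<in> C) + of_bool (u 1 x \<in> C) + of_bool (u 2 x \<in> C))"
proof -
  have "card {j\<in>{..<3::nat}. P j} = of_bool (P 0) + of_bool (P 1) + of_bool (P 2)" for P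
  proof -
    have "card {j\<in>{..<3::nat}. P j} = (\<Sum>j<3. of_bool (P j))"
      by (simp add: sum_of_bool_eq Int_def)
    also have "\<dots> = of_bool (P 0) + of_bool (P 1) + of_bool (P 2)"
      by (simp only: numeral_3_eq_3 numeral_2_eq_2 One_nat_def sum.lessThan_Suc lessThan_0 sum.empty add_0)
    finally show ?thesis .
  qed
  then show ?thesis by (simp only: cl_def)
qed

lemma cl_in_classes: "cl x \<in> classes"
proof (cases "x = (0, 0)")
  case True
  then show ?thesis by (simp add: cl_eq u_0 zero_notin_C classes_def)
next
  case False
  then have "\<not> (u 0 x = 0 \<and> u 1 x = 0)" "\<not> (u 0 x = 0 \<and> u 2 x = 0)" "\<not> (u 1 x = 0 \<and> u 2 x = 0)"
    using u_two_zeros[of 0 x 1] u_two_zeros[of 0 x 2] u_two_zeros[of 1 x 2] by auto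
  with zero_notin_C show ?thesis
    by (cases "u 0 x = 0"; cases "u 1 x = 0"; cases "u 2 x = 0") (simp_all add: cl_eq classes_def)
qed

section \<open>Sizes of the classes\<close>

definition N :: "nat \<Rightarrow> nat \<Rightarrow> real" where
  "N i j = real (card {x. cl x = (i, j)})"

lemma sum_cl:
  fixes F :: "nat \<times> nat \<Rightarrow> real"
  shows "(\<Sum>x\<in>UNIV. F (cl x)) = N 0 0 * F (0, 0) + N 0 1 * F (0, 1) + N 0 2 * F (0, 2) +
    N 0 3 * F (0, 3) + N 1 0 * F (1, 0) + N 1 1 * F (1, 1) + N 1 2 * F (1, 2) + N 3 0 * F (3, 0)"
proof -
  have "finite classes" "range cl \<subseteq> classes"
    using cl_in_classes by (simp add: classes_def, blast)
  then have "(\<Sum>x\<in>UNIV. F (cl x)) = (\<Sum>k\<in>classes. real (card {x\<in>UNIV. cl x = k}) * F k)"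
    by (intro sum_fun_comp) simp_all
  also have "\<dots> = (\<Sum>k\<in>classes. N (fst k) (snd k) * F k)" by (simp add: N_def)
  finally show ?thesis by (simp add: classes_def)
qed

lemma N_3_0: "N 3 0 = 1"
proof -
  have "cl x = (3, 0) \<longleftrightarrow> x = (0, 0)" for x
  proof
    assume "cl x = (3, 0)"
    then have "u 0 x = 0" "u 1 x = 0"
      by (simp_all only: cl_eq prod.inject add_of_bool_eq_iff)
    then show "x = (0, 0)" by (rule u_two_zeros) auto
  qed (simp add: cl_eq u_0 zero_notin_C)
  then show ?thesis by (simp add: N_def)
qed

text \<open>The sums over all (a, b) of 1, z, k, k^2 and zk. Together with \<open>N 3 0\<close>,
  \<open>N 0 3\<close> and one of \<open>N 1 1\<close>, \<open>N 1 2\<close>, they determine all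
  eight class sizes.\<close>

lemma moments:
  "N 0 0 + N 0 1 + N 0 2 + N 0 3 + N 1 0 + N 1 1 + N 1 2 + N 3 0 = (real r)\<^sup>2"
  "N 1 0 + N 1 1 + N 1 2 + 3 * N 3 0 = 3 * real r"
  "N 0 1 + 2 * N 0 2 + 3 * N 0 3 + N 1 1 + 2 * N 1 2 = 3 * real c * real r"
  "N 0 1 + 4 * N 0 2 + 9 * N 0 3 + N 1 1 + 4 * N 1 2 = 3 * real c * real r + 6 * (real c)\<^sup>2"
  "N 1 1 + 2 * N 1 2 = 6 * real c"
proof -
  have "(\<Sum>x\<in>(UNIV :: ('a \<times> 'a) set). 1) = (real r)\<^sup>2"
    by (simp add: card_UNIV power2_eq_square)
  then show "N 0 0 + N 0 1 + N 0 2 + N 0 3 + N 1 0 + N 1 1 + N 1 2 + N 3 0 = (real r)\<^sup>2"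
    using sum_cl[of "\<lambda>_. 1"] by simp
  show "N 1 0 + N 1 1 + N 1 2 + 3 * N 3 0 = 3 * real r"
    using sum_cl[of "\<lambda>k. real (fst k)"] sum_u_single[of "{0}"] by (simp only: real_fst_cl) simp
  show "N 0 1 + 2 * N 0 2 + 3 * N 0 3 + N 1 1 + 2 * N 1 2 = 3 * real c * real r"
    using sum_cl[of "\<lambda>k. real (snd k)"] sum_u_single[of C] by (simp only: real_snd_cl) (simp add: card_C)
  show "N 0 1 + 4 * N 0 2 + 9 * N 0 3 + N 1 1 + 4 * N 1 2 = 3 * real c * real r + 6 * (real c)\<^sup>2"
    using sum_cl[of "\<lambda>k. real (snd k) * real (snd k)"] sum_u_pair[of C C]
    by (simp only: real_snd_cl) (simp add: card_C power2_eq_square)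
  show "N 1 1 + 2 * N 1 2 = 6 * real c"
    using sum_cl[of "\<lambda>k. real (fst k) * real (snd k)"] sum_u_pair[of "{0}" C] zero_notin_C
    by (simp only: real_fst_cl real_snd_cl) (simp add: card_C)
qed

text \<open>Mapping (a, b) to its three points is a bijection from the class (0, 3) onto the triples
  of cubes that satisfy the linear relation. The triple count applies, and the factors
  \<open>\<beta>\<close> drop out because \<open>\<beta>\<close> is a cube.\<close>

lemma N_0_3: "real r * N 0 3 = (\<Sum>x\<in>UNIV. \<eta> (x * g\<^sup>2) * \<eta> (x * g) * \<eta> x)"
proof -
  let ?T = "{(y0, y1, y2) \<in> C \<times> C \<times> C. g\<^sup>2 * y0 + g * \<beta> * y1 + \<beta>\<^sup>2 * y2 = 0}"
  let ?f = "\<lambda>x. (u 0 x, u 1 x, u 2 x)"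
  have cl: "cl x = (0, 3) \<longleftrightarrow> u 0 x \<in> C \<and> u 1 x \<in> C \<and> u 2 x \<in> C" for x
    unfolding cl_eq prod.inject add_of_bool_eq_iff using zero_notin_C by metis
  have inj: "inj ?f"
  proof (rule injI)
    fix x y assume "?f x = ?f y"
    then have "u 0 (fst x - fst y, snd x - snd y) = 0" "u 1 (fst x - fst y, snd x - snd y) = 0"
      by (simp_all add: u_def algebra_simps)
    then have "(fst x - fst y, snd x - snd y) = (0, 0)" by (rule u_two_zeros) auto
    then show "x = y" by (simp add: prod_eq_iff)
  qed
  have image: "?f ` {x. cl x = (0, 3)} = ?T"
  proof
    show "?f ` {x. cl x = (0, 3)} \<subseteq> ?T" by (auto simp: cl u_relation[simplified])
    show "?T \<subseteq> ?f ` {x. cl x = (0, 3)}"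
    proof safe
      fix y0 y1 y2
      assume y: "y0 \<in> C" "y1 \<in> C" "y2 \<in> C" and rel: "g\<^sup>2 * y0 + g * \<beta> * y1 + \<beta>\<^sup>2 * y2 = 0"
      \<comment> \<open>Solves a + b = y0 and g(a + \<beta>b) = y1 for b; the third point then
        follows from the relation.\<close>
      define b where "b = (y1 / g - y0) / (\<beta> - 1)"
      define x where "x = (y0 - b, b)"
      have "b * (\<beta> - 1) = y1 / g - y0" using \<beta>_neq_1 by (simp add: b_def)
      then have "y0 - b + \<beta> * b = y1 / g" by (simp add: algebra_simps)
      then have u1: "u 1 x = y1" using g_nonzero by (simp add: u_def x_def)
      have u0: "u 0 x = y0" by (simp add: u_def x_def)
      have "\<beta>\<^sup>2 * u 2 x = \<beta>\<^sup>2 * y2"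
        using u_relation[of x] rel u0 u1 by (metis add_left_cancel)
      then have "u 2 x = y2" using \<beta>_nonzero by simp
      with u0 u1 y show "(y0, y1, y2) \<in> ?f ` {x. cl x = (0, 3)}"
        by (intro image_eqI[of _ _ x]) (auto simp: cl)
    qed
  qed
  have "card {x. cl x = (0, 3)} = card ?T"
    unfolding image[symmetric] by (rule card_image[symmetric], rule inj_on_subset[OF inj subset_UNIV])
  then have "real r * N 0 3 = (\<Sum>x\<in>UNIV. \<eta> (x * g\<^sup>2) * \<eta> (x * (g * \<beta>)) * \<eta> (x * \<beta>\<^sup>2))"
    by (simp only: N_def card_triples_eq_sum_\<eta>)
  also have "\<dots> = (\<Sum>x\<in>UNIV. \<eta> (x * g\<^sup>2) * \<eta> (x * g) * \<eta> x)"
  proof (rule sum.cong[OF refl])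
    fix x
    have "\<eta> (x * (g * \<beta>)) = \<eta> (x * g)" "\<eta> (x * \<beta>\<^sup>2) = \<eta> x"
      using \<eta>_mult_C[OF \<beta>_in_C, of "x * g"] \<eta>_mult_C[of "\<beta>\<^sup>2" x] C_mult_iff[OF \<beta>_in_C, of \<beta>] \<beta>_in_C
      by (simp_all add: mult.assoc power2_eq_square)
    then show "\<eta> (x * g\<^sup>2) * \<eta> (x * (g * \<beta>)) * \<eta> (x * \<beta>\<^sup>2) = \<eta> (x * g\<^sup>2) * \<eta> (x * g) * \<eta> x" by simp
  qed
  finally show ?thesis .
qed

lemma real_r_E: "real r = E\<^sup>2" and real_c_E: "real c = (E\<^sup>2 - 1) / 3"
  using E_square real_r by simp_all

text \<open>If \<open>g\<close> is a cube, the three arguments lie in the same coset and the sum is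
  the third moment of \<open>\<eta>\<close>.\<close>

lemma N_0_3_cube:
  assumes "3 dvd t"
  shows "N 0 3 = (real r - 1) / 27 * (real r - 8 - 2 * E)"
proof -
  have gC: "g \<in> C" "g\<^sup>2 \<in> C" using g_power_in_C_iff[of 1] g_power_in_C_iff[of 2] assms by simp_all
  have "real r * N 0 3 = (\<Sum>x\<in>UNIV. (\<eta> x) ^ 3)"
    unfolding N_0_3 by (simp add: \<eta>_mult_C[OF gC(1)] \<eta>_mult_C[OF gC(2)] power3_eq_cube)
  also have "\<dots> = (real c) ^ 3 + real c * ((\<eta> 1) ^ 3 + 2 * (\<eta> \<alpha>) ^ 3)"
    by (rule sum_\<eta>_cosets)
  also have "\<dots> = real r * ((real r - 1) / 27 * (real r - 8 - 2 * E))"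
    unfolding \<eta>_1' \<eta>_\<alpha> real_r_E real_c_E
    by (simp add: field_simps power2_eq_square power3_eq_cube)
  finally show ?thesis using r_gt_1 by simp
qed

text \<open>If \<open>g\<close> is not a cube, then for nonzero \<open>x\<close> the three arguments
  lie in three different cosets, so the product of periods is constant.\<close>

lemma N_0_3_noncube:
  assumes "\<not> 3 dvd t"
  shows "N 0 3 = (real r - 1) / 27 * (real r + 1 - 2 * E)"
proof -
  let ?f = "\<lambda>x. \<eta> (x * g\<^sup>2) * \<eta> (x * g) * \<eta> x"
  have f: "?f x = \<eta> 1 * (\<eta> \<alpha>)\<^sup>2" if "x \<noteq> 0" for x
  proof -
    obtain k where k: "x = \<alpha> ^ k"
      using \<open>x \<noteq> 0\<close> by (rule nonzero_powerE)
    have mem: "x \<in> C \<longleftrightarrow> 3 dvd k" "x * g \<in> C \<longleftrightarrow> 3 dvd k + t" "x * g\<^sup>2 \<in> C \<longleftrightarrow> 3 dvd k + t * 2"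
      by (simp_all add: k g_eq power_\<alpha>_in_C_iff flip: power_mult power_add)
    have "k mod 3 = 0 \<or> k mod 3 = 1 \<or> k mod 3 = 2" "t mod 3 = 1 \<or> t mod 3 = 2"
      using assms by presburger+
    moreover have "(k + t) mod 3 = (k mod 3 + t mod 3) mod 3" "(k + t * 2) mod 3 = (k mod 3 + t mod 3 * 2) mod 3"
      by (simp_all only: mod_add_eq mod_mult_left_eq mod_add_left_eq mod_add_right_eq)
        (metis mod_add_eq mod_mult_left_eq)
    \<comment> \<open>The exponents k, k + t and k + 2t are distinct modulo 3, so exactly one is a
      multiple of 3.\<close>
    ultimately have "3 dvd k \<and> \<not> 3 dvd k + t \<and> \<not> 3 dvd k + t * 2 \<or> \<not> 3 dvd k \<and> 3 dvd k + t \<and> \<not> 3 dvd k + t * 2 \<or>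
        \<not> 3 dvd k \<and> \<not> 3 dvd k + t \<and> 3 dvd k + t * 2"
      unfolding dvd_eq_mod_eq_0 by (elim disjE) simp_all
    then show ?thesis
      unfolding \<eta>_eq[of x] \<eta>_eq[of "x * g"] \<eta>_eq[of "x * g\<^sup>2"] mem
      using that g_nonzero by (auto simp: power2_eq_square)
  qed
  have nonzero: "(\<Sum>x\<in>UNIV - {0}. ?f x) = (\<Sum>x\<in>UNIV - {0 :: 'a}. \<eta> 1 * (\<eta> \<alpha>)\<^sup>2)"
    by (rule sum.cong[OF refl]) (rule f, blast)
  have "real r * N 0 3 = ?f 0 + (\<Sum>x\<in>UNIV - {0}. ?f x)"
    unfolding N_0_3 by (rule sum.remove) simp_all
  also have "\<dots> = (real c) ^ 3 + 3 * (real c * (\<eta> 1 * (\<eta> \<alpha>)\<^sup>2))"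
    unfolding nonzero sum_nonzero by (simp add: \<eta>_0 power3_eq_cube)
  also have "\<dots> = real r * ((real r - 1) / 27 * (real r + 1 - 2 * E))"
    unfolding \<eta>_1' \<eta>_\<alpha> real_r_E real_c_E
    by (simp add: field_simps power2_eq_square power3_eq_cube)
  finally show ?thesis using r_gt_1 by simp
qed

text \<open>When one point vanishes, the linear relation ties the other two; as -1 and
  \<open>\<beta>\<close> are cubes, only the power of \<open>g\<close> affects the coset.\<close>

lemma u_zero_relations:
  "u 0 x = 0 \<Longrightarrow> g * u 1 x \<in> C \<longleftrightarrow> u 2 x \<in> C"
  "u 1 x = 0 \<Longrightarrow> g\<^sup>2 * u 0 x \<in> C \<longleftrightarrow> u 2 x \<in> C"
  "u 2 x = 0 \<Longrightarrow> g * u 0 x \<in> C \<longleftrightarrow> u 1 x \<in> C"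
proof -
  have \<beta>: "- (\<beta> * y) \<in> C \<longleftrightarrow> y \<in> C" for y
    by (simp add: minus_in_C_iff C_mult_iff[OF \<beta>_in_C])
  have "\<beta> * (g * u 1 x + \<beta> * u 2 x) = 0" if "u 0 x = 0"
    using u_relation[of x] that by (simp add: algebra_simps power2_eq_square)
  then have "g * u 1 x = - (\<beta> * u 2 x)" if "u 0 x = 0"
    using that \<beta>_nonzero by (simp add: eq_neg_iff_add_eq_0)
  then show "u 0 x = 0 \<Longrightarrow> g * u 1 x \<in> C \<longleftrightarrow> u 2 x \<in> C" using \<beta> by metis
  have "g\<^sup>2 * u 0 x = - (\<beta> * (\<beta> * u 2 x))" if "u 1 x = 0"
    using u_relation[of x] that by (simp add: eq_neg_iff_add_eq_0 power2_eq_square mult.assoc)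
  then show "u 1 x = 0 \<Longrightarrow> g\<^sup>2 * u 0 x \<in> C \<longleftrightarrow> u 2 x \<in> C"
    using \<beta> C_mult_iff[OF \<beta>_in_C] by metis
  have "g * (g * u 0 x + \<beta> * u 1 x) = 0" if "u 2 x = 0"
    using u_relation[of x] that by (simp add: algebra_simps power2_eq_square)
  then have "g * u 0 x = - (\<beta> * u 1 x)" if "u 2 x = 0"
    using that g_nonzero by (simp add: eq_neg_iff_add_eq_0)
  then show "u 2 x = 0 \<Longrightarrow> g * u 0 x \<in> C \<longleftrightarrow> u 1 x \<in> C" using \<beta> by metis
qed

text \<open>With \<open>g\<close> a cube, the two points other than a vanishing one are both cubes
  or both noncubes.\<close>

lemma N_1_1_cube:
  assumes "3 dvd t"
  shows "N 1 1 = 0"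
proof -
  have g: "g \<in> C" "g\<^sup>2 \<in> C" using g_power_in_C_iff[of 1] g_power_in_C_iff[of 2] assms by simp_all
  have "cl x \<noteq> (1, 1)" for x
    using u_zero_relations[of x] zero_notin_C
    unfolding C_mult_iff[OF g(1)] C_mult_iff[OF g(2)] cl_eq prod.inject add_of_bool_eq_iff
    by metis
  then show ?thesis by (simp add: N_def)
qed

text \<open>With \<open>g\<close> and its square noncubes, the two points other than a vanishing one
  cannot both be cubes.\<close>

lemma N_1_2_noncube:
  assumes "\<not> 3 dvd t"
  shows "N 1 2 = 0"
proof -
  have "\<not> 3 dvd t * 2" using assms by presburger
  then have g: "g \<notin> C" "g\<^sup>2 \<notin> C"
    using g_power_in_C_iff[of 1] g_power_in_C_iff[of 2] assms by simp_all
  then have "g * y \<notin> C" "g\<^sup>2 * y \<notin> C" if "y \<in> C" for y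
    using C_mult_iff[OF that, of g] C_mult_iff[OF that, of "g\<^sup>2"] g by (simp_all add: mult.commute)
  then have "cl x \<noteq> (1, 2)" for x
    using u_zero_relations[of x] zero_notin_C
    unfolding cl_eq prod.inject add_of_bool_eq_iff by metis
  then show ?thesis by (simp add: N_def)
qed

section \<open>Values on the classes and the two tables\<close>

definition val :: "nat \<times> nat \<Rightarrow> real" where
  "val k = real h / real q *
    (real (fst k) * real c + real (snd k) * \<eta> 1 + (3 - real (fst k) - real (snd k)) * \<eta> \<alpha>)"

lemma modified_weight_eq_val: "modified_weight q m h n g \<beta> a b = val (cl (a, b))"
proof -
  have "\<eta> y = of_bool (y \<in> {0}) * real c + of_bool (y \<in> C) * \<eta> 1 +
      (1 - of_bool (y \<in> {0}) - of_bool (y \<in> C)) * \<eta> \<alpha>" for y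
    using zero_notin_C by (auto simp: \<eta>_eq[of y])
  then have "(\<Sum>j<3. \<eta> (u j (a, b))) = (\<Sum>j<3. of_bool (u j (a, b) \<in> {0}) * real c +
      of_bool (u j (a, b) \<in> C) * \<eta> 1 +
      (1 - of_bool (u j (a, b) \<in> {0}) - of_bool (u j (a, b) \<in> C)) * \<eta> \<alpha>)"
    by (intro sum.cong refl)
  also have "\<dots> = real (fst (cl (a, b))) * real c + real (snd (cl (a, b))) * \<eta> 1 +
      (3 - real (fst (cl (a, b))) - real (snd (cl (a, b)))) * \<eta> \<alpha>"
    unfolding real_fst_cl real_snd_cl numeral_3_eq_3 sum.lessThan_Suc lessThan_0 sum.empty
    by (simp add: algebra_simps)
  finally show ?thesis by (simp only: modified_weight_eq val_def)
qed

text \<open>The list may omit empty classes: (1, 1) if \<open>g\<close> is a cube, (1, 2)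
  otherwise.\<close>

lemma has_value_distribution_val:
  assumes "distinct S" "\<And>k. k \<in> classes - set S \<Longrightarrow> N (fst k) (snd k) = 0"
  shows "has_value_distribution (\<lambda>(a, b). modified_weight q m h n g \<beta> a b)
    (map (\<lambda>k. (val k, N (fst k) (snd k))) S)"
proof -
  have "range cl \<subseteq> set S"
  proof (rule image_subsetI, rule ccontr)
    fix x assume "cl x \<notin> set S"
    then have "N (fst (cl x)) (snd (cl x)) = 0" using assms(2) cl_in_classes by blast
    then have "{y. cl y = cl x} = {}" by (simp add: N_def)
    then show False by blast
  qed
  then have "has_value_distribution (\<lambda>(a, b). modified_weight q m h n g \<beta> a b)
      (map (\<lambda>k. (val k, real (card {x. cl x = k}))) S)"
    using assms(1) by (intro has_value_distribution_classes) (auto simp: modified_weight_eq_val)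
  then show ?thesis by (simp add: N_def)
qed

text \<open>The moment equations in triangular form, with \<open>N 1 1\<close> and
  \<open>N 0 3\<close> as parameters.\<close>

lemma N_eqs:
  "N 1 2 = real r - 1 - N 1 1 / 2"
  "N 1 0 = 2 * (real r - 1) - N 1 1 / 2"
  "N 0 2 = (real r - 1)\<^sup>2 / 3 - 3 * N 0 3 - N 1 2"
  "N 0 1 = (real r - 1) * real r - 2 * N 0 2 - 3 * N 0 3 - 2 * (real r - 1)"
  "N 0 0 = (real r)\<^sup>2 - N 0 1 - N 0 2 - N 0 3 - 3 * (real r - 1) - 1"
proof -
  have c: "3 * real c = real r - 1" using real_r by simp
  then have c2: "6 * (real c)\<^sup>2 = 2 * ((real r - 1)\<^sup>2 / 3)" "3 * real c * real r = (real r - 1) * real r"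
    by (simp_all add: power2_eq_square flip: c)
  show N12: "N 1 2 = real r - 1 - N 1 1 / 2"
    using moments(5) c by linarith
  show N10: "N 1 0 = 2 * (real r - 1) - N 1 1 / 2"
    using moments(2) unfolding N_3_0 N12 by (simp add: field_simps)
  \<comment> \<open>The difference of the second and first moments of k counts ordered pairs of
    distinct cube points.\<close>
  show "N 0 2 = (real r - 1)\<^sup>2 / 3 - 3 * N 0 3 - N 1 2"
    using moments(3,4) c2(1) by linarith
  show "N 0 1 = (real r - 1) * real r - 2 * N 0 2 - 3 * N 0 3 - 2 * (real r - 1)"
    using moments(3) unfolding N12 c2(2) by (simp add: field_simps)
  show "N 0 0 = (real r)\<^sup>2 - N 0 1 - N 0 2 - N 0 3 - 3 * (real r - 1) - 1"
    using moments(1) unfolding N_3_0 N10 N12 by (simp add: field_simps)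
qed

lemma val_eqs:
  "val (0, 3) = - (real h / real q) * (2 * E + 1)"
  "val (0, 0) = real h / real q * (E - 1)"
  "val (0, 2) = - (real h / real q) * (E + 1)"
  "val (0, 1) = - (real h / real q)"
  "val (1, 2) = real h / (3 * real q) * (real r - 4 * E - 3)"
  "val (1, 1) = real h / (3 * real q) * (real r - E - 3)"
  "val (1, 0) = real h / (3 * real q) * (real r + 2 * E - 3)"
  "val (3, 0) = real h * (real r - 1) / real q"
proof -
  have val: "val k = real h / real q * (real (fst k) * ((real r - 1) / 3) +
      real (snd k) * (- (2 * E + 1) / 3) + (3 - real (fst k) - real (snd k)) * ((E - 1) / 3))" for k
    using real_r by (simp add: val_def \<eta>_1' \<eta>_\<alpha>)
  \<comment> \<open>Pulling out the common factor h/q leaves linear identities in \<open>r\<close>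
    and \<open>E\<close>.\<close>
  have *: "- (real h / real q) * y = real h / real q * (- y)"
    "- (real h / real q) = real h / real q * (- 1)"
    "real h * y / real q = real h / real q * y"
    "real h / (3 * real q) * y = real h / real q * (y / 3)" for y by simp_all
  note cong = arg_cong[where f = "(*) (real h / real q)"]
  show "val (0, 0) = real h / real q * (E - 1)"
    unfolding val by (intro cong) (simp add: field_simps)
  show "val (0, 3) = - (real h / real q) * (2 * E + 1)" "val (0, 2) = - (real h / real q) * (E + 1)"
    unfolding val *(1) by (intro cong; simp add: field_simps)+
  show "val (0, 1) = - (real h / real q)"
    unfolding val *(2) by (intro cong) (simp add: field_simps)
  show "val (3, 0) = real h * (real r - 1) / real q"
    unfolding val *(3) by (intro cong) (simp add: field_simps)
  show "val (1, 2) = real h / (3 * real q) * (real r - 4 * E - 3)"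
    "val (1, 1) = real h / (3 * real q) * (real r - E - 3)"
    "val (1, 0) = real h / (3 * real q) * (real r + 2 * E - 3)"
    unfolding val *(4) by (intro cong; simp add: field_simps)+
qed

lemma distribution_cube:
  assumes "3 dvd t"
  shows "has_value_distribution (\<lambda>(a, b). modified_weight q m h n g \<beta> a b)
        [(- (real h / real q) * (2 * E + 1), (real r - 1) / 27 * (real r - 8 - 2 * E)),
         (real h / real q * (E - 1), 2 * (real r - 1) / 27 * (4 * real r - 14 + E)),
         (- (real h / real q) * (E + 1), 2 * (real r - 1) / 9 * (real r - 2 + E)),
         (- (real h / real q), 2 * (real r - 1) / 9 * (2 * real r - 1 - E)),
         (real h / (3 * real q) * (real r - 4 * E - 3), real r - 1),
         (real h / (3 * real q) * (real r + 2 * E - 3), 2 * (real r - 1)),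
         (real h * (real r - 1) / real q, 1)]" (is "has_value_distribution _ ?T")
proof -
  \<comment> \<open>The classes in the order of the table rows, without the empty class (1,
    1).\<close>
  let ?S = "[(0, 3), (0, 0), (0, 2), (0, 1), (1, 2), (1, 0), (3, 0)] :: (nat \<times> nat) list"
  note N03 = N_0_3_cube[OF assms]
  have N12: "N 1 2 = real r - 1" and N10: "N 1 0 = 2 * (real r - 1)"
    using N_eqs(1,2) N_1_1_cube[OF assms] by simp_all
  have N02: "N 0 2 = 2 * (real r - 1) / 9 * (real r - 2 + E)"
    unfolding N_eqs(3) N03 N12 by (simp add: field_simps power2_eq_square)
  have N01: "N 0 1 = 2 * (real r - 1) / 9 * (2 * real r - 1 - E)"
    unfolding N_eqs(4) N02 N03 by (simp add: field_simps power2_eq_square)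
  have N00: "N 0 0 = 2 * (real r - 1) / 27 * (4 * real r - 14 + E)"
    unfolding N_eqs(5) N01 N02 N03 by (simp add: field_simps power2_eq_square)
  have "map (\<lambda>k. (val k, N (fst k) (snd k))) ?S = ?T"
    by (simp only: list.map fst_conv snd_conv val_eqs N00 N01 N02 N03 N10 N12 N_3_0)
  moreover have "has_value_distribution (\<lambda>(a, b). modified_weight q m h n g \<beta> a b)
      (map (\<lambda>k. (val k, N (fst k) (snd k))) ?S)"
    by (rule has_value_distribution_val) (use N_1_1_cube[OF assms] in \<open>auto simp: classes_def\<close>)
  ultimately show ?thesis by (simp only:)
qed

lemma distribution_noncube:
  assumes "\<not> 3 dvd t"
  shows "has_value_distribution (\<lambda>(a, b). modified_weight q m h n g \<beta> a b)
        [(- (real h / real q) * (2 * E + 1), (real r - 1) / 27 * (real r + 1 - 2 * E)),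
         (real h / real q * (E - 1), 2 * (real r - 1) / 27 * (4 * real r - 5 + E)),
         (- (real h / real q) * (E + 1), 2 * (real r - 1) / 9 * (real r - 2 + E)),
         (- (real h / real q), (real r - 1) / 9 * (4 * real r - 11 - 2 * E)),
         (real h / (3 * real q) * (real r + 2 * E - 3), real r - 1),
         (real h / (3 * real q) * (real r - E - 3), 2 * (real r - 1)),
         (real h * (real r - 1) / real q, 1)]" (is "has_value_distribution _ ?T")
proof -
  \<comment> \<open>As before, but now the empty class is (1, 2).\<close>
  let ?S = "[(0, 3), (0, 0), (0, 2), (0, 1), (1, 0), (1, 1), (3, 0)] :: (nat \<times> nat) list"
  note N03 = N_0_3_noncube[OF assms] and N12 = N_1_2_noncube[OF assms]
  have N11: "N 1 1 = 2 * (real r - 1)" and N10: "N 1 0 = real r - 1"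
    using N_eqs(1,2) N12 by simp_all
  have N02: "N 0 2 = 2 * (real r - 1) / 9 * (real r - 2 + E)"
    unfolding N_eqs(3) N03 N12 by (simp add: field_simps power2_eq_square)
  have N01: "N 0 1 = (real r - 1) / 9 * (4 * real r - 11 - 2 * E)"
    unfolding N_eqs(4) N02 N03 by (simp add: field_simps power2_eq_square)
  have N00: "N 0 0 = 2 * (real r - 1) / 27 * (4 * real r - 5 + E)"
    unfolding N_eqs(5) N01 N02 N03 by (simp add: field_simps power2_eq_square)
  have "map (\<lambda>k. (val k, N (fst k) (snd k))) ?S = ?T"
    by (simp only: list.map fst_conv snd_conv val_eqs N00 N01 N02 N03 N10 N11 N_3_0)
  moreover have "has_value_distribution (\<lambda>(a, b). modified_weight q m h n g \<beta> a b)
      (map (\<lambda>k. (val k, N (fst k) (snd k))) ?S)"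
    by (rule has_value_distribution_val) (use N12 in \<open>auto simp: classes_def\<close>)
  ultimately show ?thesis by (simp only:)
qed

end

theorem theorem1:
  fixes p s m q r h n :: nat
    and \<alpha> g \<beta> :: "'a::{field,finite}"
    and \<epsilon> :: real
  assumes "prime p" and "p mod 3 = 2"
    and "s > 0" and "m > 0"
    and "q = p ^ s" and "r = q ^ m"
    and "CARD('a) = r"
    and "primitive_element \<alpha>"
    and "h > 0" and "h dvd q - 1"
    and "3 dvd gcd (q - 1) (h * m)"
    and "g = \<alpha> ^ ((q - 1) div h)"
    and "n = h * (r - 1) div (q - 1)"
    and "\<beta> = \<alpha> ^ ((r - 1) div 3)"
    and "gcd ((r - 1) div (q - 1)) (3 * (q - 1) div h) = 3"
    and "\<epsilon> = (-1) ^ (m * s div 2)"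
  shows "(3 dvd (q - 1) div h \<longrightarrow>
      has_value_distribution (\<lambda>(a, b). modified_weight q m h n g \<beta> a b)
        [(- (real h / real q) * (2 * \<epsilon> * sqrt (real r) + 1), (real r - 1) / 27 * (real r - 8 - 2 * \<epsilon> * sqrt (real r))),
         (real h / real q * (\<epsilon> * sqrt (real r) - 1), 2 * (real r - 1) / 27 * (4 * real r - 14 + \<epsilon> * sqrt (real r))),
         (- (real h / real q) * (\<epsilon> * sqrt (real r) + 1), 2 * (real r - 1) / 9 * (real r - 2 + \<epsilon> * sqrt (real r))),
         (- (real h / real q), 2 * (real r - 1) / 9 * (2 * real r - 1 - \<epsilon> * sqrt (real r))),
         (real h / (3 * real q) * (real r - 4 * \<epsilon> * sqrt (real r) - 3), real r - 1),
         (real h / (3 * real q) * (real r + 2 * \<epsilon> * sqrt (real r) - 3), 2 * (real r - 1)),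
         (real h * (real r - 1) / real q, 1)])
    \<and> (\<not> 3 dvd (q - 1) div h \<longrightarrow>
      has_value_distribution (\<lambda>(a, b). modified_weight q m h n g \<beta> a b)
        [(- (real h / real q) * (2 * \<epsilon> * sqrt (real r) + 1), (real r - 1) / 27 * (real r + 1 - 2 * \<epsilon> * sqrt (real r))),
         (real h / real q * (\<epsilon> * sqrt (real r) - 1), 2 * (real r - 1) / 27 * (4 * real r - 5 + \<epsilon> * sqrt (real r))),
         (- (real h / real q) * (\<epsilon> * sqrt (real r) + 1), 2 * (real r - 1) / 9 * (real r - 2 + \<epsilon> * sqrt (real r))),
         (- (real h / real q), (real r - 1) / 9 * (4 * real r - 11 - 2 * \<epsilon> * sqrt (real r))),
         (real h / (3 * real q) * (real r + 2 * \<epsilon> * sqrt (real r) - 3), real r - 1),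
         (real h / (3 * real q) * (real r - \<epsilon> * sqrt (real r) - 3), 2 * (real r - 1)),
         (real h * (real r - 1) / real q, 1)])"
proof -
  have gcd3: "gcd ((r - 1) div (q - 1)) (3 * (q - 1) div h) = 3" by fact
  interpret cubic_code p s m q r \<alpha> h n g \<beta>
  proof
    show "3 dvd q - 1" using assms(11) by simp
    show "3 dvd (r - 1) div (q - 1)" using gcd_dvd1 gcd3 by metis
  qed (use assms in auto)
  have E: "\<epsilon> * sqrt (real r) = E" by (simp add: assms(16) E_def)
  \<comment> \<open>Products associate to the left, so \<open>\<epsilon> * sqrt (real r)\<close> is
    not a subterm of these products and each needs its own rewrite rule.\<close>
  then have E': "2 * \<epsilon> * sqrt (real r) = 2 * E" "4 * \<epsilon> * sqrt (real r) = 4 * E"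
    by simp_all
  show ?thesis
    unfolding E E'
    by (intro conjI impI distribution_cube[unfolded t_def] distribution_noncube[unfolded t_def])
qed

end
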